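(* Let $1\le p<n$ be integers, let $O\subset\tilde Q$ be the set of all elements of the form $q_{i,i}$ and let $C=\tilde Q\setminus O$. Let $\mathcal A\subset\mathbb C[\{z_{i,j}^{(k)}\}]$ be the subalgebra generated by the monomials $\mathrm{in}_{<_{\mathrm{pbw}}}D_I^{(k)}$ with $I^{(k)}\in\tilde{\mathcal I}_{\mathrm{pbw}}$. Then $\mathcal A$ is isomorphic to $A_{O,C}(\tilde Q,\prec)$ as an $\mathbb N_0$-graded algebra, with the isomorphism given by $$\mathrm{in}_{<_{\mathrm{pbw}}}D_I^{(k)}\mapsto(-1)^{r(p-1)}\,s\,\mathbf y^{v_{O,C}(\varphi_{\mathrm{pbw}}(I^{(k)}))}\qquad (I^{(k)}\in\tilde{\mathcal I}_{\mathrm{pbw}}),$$ where $r\in[0,p-1]$ and $k\equiv r\pmod p$.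
   Context: Notation: $\mathbb N_0=\{0,1,2,\dots\}$, and $[a,b]$ denotes the set of integers $x$ with $a\le x\le b$. Fix integers $1\le p<n$. For an integer $a$, "$a \bmod n$" denotes the representative of $a$ modulo $n$ lying in $[1,n]$; $\bmod$ is performed after addition and subtraction. Consider variables $z_{i,j}^{(k)}$ with $i\in[1,p]$, $j\in[1,n]$, $k\in\mathbb N_0$. Let $z_{i,j}(t)=\sum_{k\ge 0} z_{i,j}^{(k)}t^k$ and let $Z(t)$ be the $p\times n$ matrix with entries $z_{i,j}(t)$. For a $p$-tuple $I=(\alpha_1,\dots,\alpha_p)$ of integers in $[1,n]$ let $Z_I(t)$ be the $p\times p$ matrix whose $j$th column is the $\alpha_j$th column of $Z(t)$; let $D_I(t)=\det Z_I(t)$ and let $D_I^{(k)}$ be the coefficient of $t^k$ in $D_I(t)$. For a monomial order $<$, $\mathrm{in}_<(f)$ is the $<$-maximal term of $f$ (with its coefficient). Given an ordering $x_1,x_2,\dots$ of the variables, the degree reverse lexicographic order is: $\prod x_i^{a_i}<\prod x_i^{b_i}$ iff $\sum a_i<\sum b_i$, or $\sum a_i=\sum b_i$ and the last non-zero entry of $a-b$ is positive. The order $<_{\mathrm{pbw}}$ is the degree reverse lexicographic order on $\mathbb C[\{z_{i,j}^{(k)}\}]$ given by ordering the $z_{i,j}^{(k)}$ first by $k$ increasingly, then by $i$ increasingly, and for given $k$ and $i$ cyclically in $j$ starting with $j=kp+i\bmod n$, i.e. with $c=(kp+i\bmod n)$, as $z_{i,c}^{(k)},z_{i,c+1}^{(k)},\dots,z_{i,n}^{(k)},z_{i,1}^{(k)},\dots,z_{i,c-1}^{(k)}$.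 The $\mathbb N_0$-grading on $\mathcal A$ has all $\mathrm{in}_{<_{\mathrm{pbw}}}D_I^{(k)}$ in degree $1$ (total degree divided by $p$). A tuple $(\alpha_1,\dots,\alpha_p)$ of integers in $[1,n]$ is a PBW tuple if the $\alpha_j$ are pairwise distinct, $\alpha_j\le p$ implies $\alpha_j=j$, and $\alpha_j>\alpha_k>p$ implies $j<k$. $\tilde{\mathcal I}_{\mathrm{pbw}}$ is the set of symbols $I^{(k)}$ with $I=(\alpha_1,\dots,\alpha_p)$ a $p$-tuple in $[1,n]$ and $k\in\mathbb N_0$ such that $(\alpha_1-k\bmod n,\dots,\alpha_p-k\bmod n)$ is a PBW tuple. The poset $(\tilde Q,\prec)$ consists of elements $q_{i,j}$ with integers $i\ge1$, $j\ge p+1$, $j-i\in[0,n-1]$, where $q_{i_1,j_1}\preceq q_{i_2,j_2}$ iff at least one of: (i) $i_1\le i_2$ and $j_1\le j_2$; (ii) $i_1+p\le i_2$; (iii) $j_1+n-p\le j_2$. $\mathcal J(\tilde Q)$ is the set of finite order ideals (finite down-closed subsets). For $I^{(k)}\in\tilde{\mathcal I}_{\mathrm{pbw}}$ with $I=(\alpha_1,\dots,\alpha_p)$, $\varphi_{\mathrm{pbw}}(I^{(k)})\in\mathcal J(\tilde Q)$ is the minimal order ideal containing all elements $q_{k+i,\,k+(\alpha_i-k\bmod n)}$ with $i\in[1,p]$ and $k+(\alpha_i-k\bmod n)>p$. For a partition $O\sqcup C=\tilde Q$ and $J\in\mathcal J(\tilde Q)$ let $v_{O,C}(J)\in\mathbb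 R^{\tilde Q}$ be the point with $v_{O,C}(J)_q=1$ if $q\in J\cap O$ or $q\in\max_\prec(J)\cap C$, and $0$ otherwise, where $\max_\prec(J)$ is the set of $\prec$-maximal elements of $J$. In the polynomial ring $\mathbb C[\{y_q\}_{q\in\tilde Q}][s]$, graded by degree in $s$, $A_{O,C}(\tilde Q,\prec)$ is the subalgebra generated by the monomials $s\,\mathbf y^{v_{O,C}(J)}$, $J\in\mathcal J(\tilde Q)$, where $\mathbf y^u=\prod_q y_q^{u_q}$. *)

theory Defs
  imports
    "Jordan_Normal_Form.Determinant"
    "HOL-Library.Poly_Mapping"
    "HOL-Computational_Algebra.Polynomial"
    "HOL-Computational_Algebra.Formal_Power_Series"
begin

section \<open>Polynomials in infinitely many variables\<close>

text \<open>Monomials are finitely supported exponent vectors, and polynomials are finitely supported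
  coefficient functions on monomials; \<open>*\<close> is the convolution product of \<open>Poly_Mapping\<close>.\<close>

type_synonym 'v monomial = "'v \<Rightarrow>\<^sub>0 nat"
type_synonym 'v cpoly = "'v monomial \<Rightarrow>\<^sub>0 complex"

definition cpoly_const :: "complex \<Rightarrow> 'v cpoly" where
  "cpoly_const c = Poly_Mapping.single 0 c"

definition cpoly_var :: "'v \<Rightarrow> 'v cpoly" where
  "cpoly_var x = Poly_Mapping.single (Poly_Mapping.single x 1) 1"

definition mdegree :: "'v monomial \<Rightarrow> nat" where
  "mdegree m = (\<Sum>x\<in>Poly_Mapping.keys m. Poly_Mapping.lookup m x)"

text \<open>Degree reverse lexicographic order for variables \<open>V\<close> listed in the order \<open>before\<close>;
  the clause on \<open>x\<close> says that the last nonzero entry of \<open>a - b\<close> is positive.\<close>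

definition degrevlex_less ::
    "'v set \<Rightarrow> ('v \<Rightarrow> 'v \<Rightarrow> bool) \<Rightarrow> 'v monomial \<Rightarrow> 'v monomial \<Rightarrow> bool" where
  "degrevlex_less V before a b \<longleftrightarrow>
     mdegree a < mdegree b \<or>
     mdegree a = mdegree b \<and>
       (\<exists>x\<in>V. Poly_Mapping.lookup a x > Poly_Mapping.lookup b x \<and>
          (\<forall>y\<in>V. before x y \<longrightarrow> Poly_Mapping.lookup a y = Poly_Mapping.lookup b y))"

definition initial_term ::
    "('v monomial \<Rightarrow> 'v monomial \<Rightarrow> bool) \<Rightarrow> 'v cpoly \<Rightarrow> 'v cpoly" where
  "initial_term lt f =
     (if f = 0 then 0
      else let m = (THE m. m \<in> Poly_Mapping.keys f \<and>
                       (\<forall>m'\<in>Poly_Mapping.keys f. m' \<noteq> m \<longrightarrow> lt m' m))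
           in Poly_Mapping.single m (Poly_Mapping.lookup f m))"

section \<open>Complex algebras\<close>

text \<open>A complex algebra is given by a commutative ring together with its structure map
  \<open>emb\<close> from the complex numbers. Subalgebras are unital.\<close>

definition is_subalgebra :: "(complex \<Rightarrow> 'a::comm_ring_1) \<Rightarrow> 'a set \<Rightarrow> bool" where
  "is_subalgebra emb S \<longleftrightarrow>
     range emb \<subseteq> S \<and> (\<forall>x\<in>S. \<forall>y\<in>S. x + y \<in> S) \<and> (\<forall>x\<in>S. \<forall>y\<in>S. x * y \<in> S)"

definition generated_subalgebra :: "(complex \<Rightarrow> 'a::comm_ring_1) \<Rightarrow> 'a set \<Rightarrow> 'a set" where
  "generated_subalgebra emb G = is_subalgebra emb hull G"

text \<open>\<open>dA d\<close> and \<open>dB d\<close> are the homogeneous components of degree \<open>d\<close> of \<open>A\<close> and \<open>B\<close>.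
  Compatibility with the structure maps gives complex linearity and preservation of \<open>1\<close>.\<close>

definition graded_algebra_iso ::
    "(complex \<Rightarrow> 'a::comm_ring_1) \<Rightarrow> 'a set \<Rightarrow> (nat \<Rightarrow> 'a set) \<Rightarrow>
     (complex \<Rightarrow> 'b::comm_ring_1) \<Rightarrow> 'b set \<Rightarrow> (nat \<Rightarrow> 'b set) \<Rightarrow> ('a \<Rightarrow> 'b) \<Rightarrow> bool" where
  "graded_algebra_iso embA A dA embB B dB f \<longleftrightarrow>
     bij_betw f A B \<and>
     (\<forall>c. f (embA c) = embB c) \<and>
     (\<forall>x\<in>A. \<forall>y\<in>A. f (x + y) = f x + f y) \<and>
     (\<forall>x\<in>A. \<forall>y\<in>A. f (x * y) = f x * f y) \<and>
     (\<forall>d. f ` dA d = dB d)"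

section \<open>The minors and the PBW monomial order\<close>

text \<open>Representative of \<open>a\<close> modulo \<open>n\<close> in \<open>{1..n}\<close>.\<close>

definition rmod :: "int \<Rightarrow> nat \<Rightarrow> int" where
  "rmod a n = (a - 1) mod int n + 1"

text \<open>\<open>(i, j, k)\<close> stands for the variable \<open>z\<^sub>i\<^sub>j\<close> with superscript \<open>k\<close>; only indices in
  \<open>zvars p n\<close> are ever used.\<close>

type_synonym zvar = "nat \<times> int \<times> nat"

definition zvars :: "nat \<Rightarrow> nat \<Rightarrow> zvar set" where
  "zvars p n = {(i, j, k). i \<in> {1..p} \<and> j \<in> {1..int n}}"

definition z_series :: "nat \<Rightarrow> int \<Rightarrow> zvar cpoly fps" where
  "z_series i j = Abs_fps (\<lambda>k. cpoly_var (i, j, k))"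

text \<open>A tuple \<open>(\<alpha>\<^sub>1, \<dots>, \<alpha>\<^sub>p)\<close> is a list of length \<open>p\<close>, with \<open>\<alpha>\<^sub>j\<close> being \<open>I ! (j - 1)\<close>. Matrix
  indices start at \<open>0\<close>.\<close>

definition Z_mat :: "nat \<Rightarrow> int list \<Rightarrow> zvar cpoly fps mat" where
  "Z_mat p I = mat p p (\<lambda>(i, j). z_series (i + 1) (I ! j))"

definition D_coeff :: "nat \<Rightarrow> int list \<Rightarrow> nat \<Rightarrow> zvar cpoly" where
  "D_coeff p I k = fps_nth (det (Z_mat p I)) k"

text \<open>For fixed \<open>k\<close> and \<open>i\<close>, the position of \<open>j\<close> in the cyclic sequence
  \<open>c, c + 1, \<dots>, n, 1, \<dots>, c - 1\<close> is \<open>(j - c) mod n\<close>.\<close>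

definition pbw_before :: "nat \<Rightarrow> nat \<Rightarrow> zvar \<Rightarrow> zvar \<Rightarrow> bool" where
  "pbw_before p n = (\<lambda>(i, j, k) (i', j', k').
     k < k' \<or>
     k = k' \<and> (i < i' \<or>
       i = i' \<and> (let c = rmod (int k * int p + int i) n
                 in (j - c) mod int n < (j' - c) mod int n)))"

definition pbw_less :: "nat \<Rightarrow> nat \<Rightarrow> zvar monomial \<Rightarrow> zvar monomial \<Rightarrow> bool" where
  "pbw_less p n = degrevlex_less (zvars p n) (pbw_before p n)"

definition in_pbw_D :: "nat \<Rightarrow> nat \<Rightarrow> int list \<Rightarrow> nat \<Rightarrow> zvar cpoly" where
  "in_pbw_D p n I k = initial_term (pbw_less p n) (D_coeff p I k)"

definition pbw_tuple :: "nat \<Rightarrow> nat \<Rightarrow> int list \<Rightarrow> bool" where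
  "pbw_tuple p n a \<longleftrightarrow>
     length a = p \<and> set a \<subseteq> {1..int n} \<and> distinct a \<and>
     (\<forall>j\<in>{1..p}. a ! (j - 1) \<le> int p \<longrightarrow> a ! (j - 1) = int j) \<and>
     (\<forall>j\<in>{1..p}. \<forall>k\<in>{1..p}. a ! (j - 1) > a ! (k - 1) \<and> a ! (k - 1) > int p \<longrightarrow> j < k)"

text \<open>The symbol \<open>I\<close> with superscript \<open>(k)\<close> is the pair \<open>(I, k)\<close>.\<close>

definition I_pbw :: "nat \<Rightarrow> nat \<Rightarrow> (int list \<times> nat) set" where
  "I_pbw p n = {(I, k). length I = p \<and> set I \<subseteq> {1..int n} \<and>
                        pbw_tuple p n (map (\<lambda>a. rmod (a - int k) n) I)}"

definition A_pbw :: "nat \<Rightarrow> nat \<Rightarrow> zvar cpoly set" where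
  "A_pbw p n = generated_subalgebra cpoly_const {in_pbw_D p n I k |I k. (I, k) \<in> I_pbw p n}"

definition A_pbw_degree :: "nat \<Rightarrow> nat \<Rightarrow> nat \<Rightarrow> zvar cpoly set" where
  "A_pbw_degree p n d = {f \<in> A_pbw p n. \<forall>m\<in>Poly_Mapping.keys f. mdegree m = p * d}"

section \<open>The poset and its interpolating algebras\<close>

text \<open>\<open>(i, j)\<close> stands for the element \<open>q\<^sub>i\<^sub>j\<close>.\<close>

type_synonym qelt = "int \<times> int"

definition Q_poset :: "nat \<Rightarrow> nat \<Rightarrow> qelt set" where
  "Q_poset p n = {(i, j). i \<ge> 1 \<and> j \<ge> int p + 1 \<and> j - i \<in> {0..int n - 1}}"

definition Q_le :: "nat \<Rightarrow> nat \<Rightarrow> qelt \<Rightarrow> qelt \<Rightarrow> bool" where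
  "Q_le p n = (\<lambda>(i1, j1) (i2, j2).
     (i1 \<le> i2 \<and> j1 \<le> j2) \<or> i1 + int p \<le> i2 \<or> j1 + int n - int p \<le> j2)"

definition order_ideals :: "nat \<Rightarrow> nat \<Rightarrow> qelt set set" where
  "order_ideals p n = {J. J \<subseteq> Q_poset p n \<and> finite J \<and>
     (\<forall>x\<in>J. \<forall>y\<in>Q_poset p n. Q_le p n y x \<longrightarrow> y \<in> J)}"

definition Q_max :: "nat \<Rightarrow> nat \<Rightarrow> qelt set \<Rightarrow> qelt set" where
  "Q_max p n J = {q \<in> J. \<forall>q'\<in>J. Q_le p n q q' \<longrightarrow> q' = q}"

definition phi_pbw :: "nat \<Rightarrow> nat \<Rightarrow> int list \<Rightarrow> nat \<Rightarrow> qelt set" where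
  "phi_pbw p n I k =
     (\<lambda>J. J \<in> order_ideals p n) hull
       {(int k + int i, int k + rmod (I ! (i - 1) - int k) n) |i.
          i \<in> {1..p} \<and> int k + rmod (I ! (i - 1) - int k) n > int p}"

text \<open>The 0/1 point attached to an ideal is kept as a natural number valued function, since its
  coordinates serve as exponents.\<close>

definition v_OC :: "nat \<Rightarrow> nat \<Rightarrow> qelt set \<Rightarrow> qelt set \<Rightarrow> qelt set \<Rightarrow> qelt \<Rightarrow> nat" where
  "v_OC p n Os Cs J q = (if q \<in> J \<inter> Os \<or> q \<in> Q_max p n J \<inter> Cs then 1 else 0)"

definition y_power :: "(qelt \<Rightarrow> nat) \<Rightarrow> qelt cpoly" where
  "y_power u = (\<Prod>q\<in>{q. u q \<noteq> 0}. cpoly_var q ^ u q)"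

text \<open>The ring with the extra variable \<open>s\<close> is the univariate polynomial ring over the polynomials
  in \<open>y\<close>, so \<open>degree\<close> and \<open>coeff\<close> refer to \<open>s\<close>.\<close>

definition ys_const :: "complex \<Rightarrow> qelt cpoly poly" where
  "ys_const c = [:cpoly_const c:]"

definition s_y :: "(qelt \<Rightarrow> nat) \<Rightarrow> qelt cpoly poly" where
  "s_y u = monom (y_power u) 1"

definition A_OC :: "nat \<Rightarrow> nat \<Rightarrow> qelt set \<Rightarrow> qelt set \<Rightarrow> qelt cpoly poly set" where
  "A_OC p n Os Cs =
     generated_subalgebra ys_const {s_y (v_OC p n Os Cs J) |J. J \<in> order_ideals p n}"

definition A_OC_degree ::
    "nat \<Rightarrow> nat \<Rightarrow> qelt set \<Rightarrow> qelt set \<Rightarrow> nat \<Rightarrow> qelt cpoly poly set" where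
  "A_OC_degree p n Os Cs d = {g \<in> A_OC p n Os Cs. \<forall>e. e \<noteq> d \<longrightarrow> coeff g e = 0}"

end

theory Submission
  imports Defs
begin

text \<open>Index the variables by cells \<open>(a, b)\<close> with \<open>a \<ge> 1\<close> and \<open>0 \<le> b - a < n\<close>: row \<open>i\<close> and superscript
  \<open>\<kappa>\<close> are merged into \<open>a = \<kappa> p + i\<close>, and \<open>b\<close> lifts the column. The order of the variables becomes
  lexicographic, and a greedy choice from the largest variable downwards shows that the initial
  term for \<open>(I, k)\<close> is, up to the sign of a cyclic shift, the product over the cells
  \<open>(k + c, k + \<beta>\<^sub>c)\<close>, \<open>1 \<le> c \<le> p\<close>, where \<open>\<beta>\<^sub>c = \<alpha>\<^sub>c - k mod n\<close>. The cells off the diagonal are exactly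
  the maximal off-diagonal elements of the order ideal attached to \<open>(I, k)\<close>, and this ideal contains
  \<open>(a, a)\<close> iff \<open>p < a \<le> k + p\<close>. Hence for a product of generators both kinds of monomials carry the
  same information: the multiplicities of the off-diagonal cells together with the multiset of the
  superscripts. So the two monoids of exponents are isomorphic, and with them the monomial
  algebras.\<close>

section \<open>Linear extensions of monoid homomorphisms\<close>

text \<open>Reverse lexicographic order penalises late variables, so the initial term is the one
  whose cells come as early as possible. Two facts make that choice rigid. The superscripts in a
  term add up to \<open>k\<close>, so all terms of one coefficient have the same sum of first
  coordinates. And the PBW condition makes the shifted entries above \<open>p\<close> decrease along
  the tuple, so keeping the columns in their given order is best in every row, counted from the
  last.

  The obstacle to an explicit isomorphism is that the diagonal y-exponents do not occur as exponents
  on the z side: they count superscripts. The exponent map is therefore defined through words in the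
  generators, and it has to be shown that equality of z-monomials and equality of y-monomials are
  the same relation on words. Superscripts are recovered from row sums on the z side and from
  diagonal exponents on the y side; the latter do not see the superscript 0, and there the degree in
  \<open>s\<close> steps in. Signs stay outside the monoids: being scalars they do not change the
  generated algebra, and they return only in the values on generators.\<close>

lemma is_subalgebra_generated: "is_subalgebra emb (generated_subalgebra emb X)"
  unfolding generated_subalgebra_def
proof (rule hull_in)
  fix T assume T: "\<forall>S\<in>T. is_subalgebra emb S"
  then have "range emb \<subseteq> S" "\<forall>x\<in>S. \<forall>y\<in>S. x + y \<in> S" "\<forall>x\<in>S. \<forall>y\<in>S. x * y \<in> S" if "S \<in> T" for S
    using that unfolding is_subalgebra_def by simp_all
  then show "is_subalgebra emb (\<Inter> T)"
    unfolding is_subalgebra_def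
    by (intro conjI ballI InterI Inter_greatest) (simp_all only: Inter_iff)
qed

lemma poly_mapping_keys_induct [consumes 1, case_names zero add]:
  fixes P :: "'m \<Rightarrow>\<^sub>0 'c::comm_monoid_add"
  assumes "Poly_Mapping.keys P \<subseteq> S"
    and zero: "Q 0"
    and add: "\<And>m c R. m \<in> S \<Longrightarrow> Poly_Mapping.keys R \<subseteq> S \<Longrightarrow> Q R \<Longrightarrow> Q (Poly_Mapping.single m c + R)"
  shows "Q P"
proof -
  have "Q (\<Sum>m\<in>F. Poly_Mapping.single m (Poly_Mapping.lookup P m)) \<and>
      Poly_Mapping.keys (\<Sum>m\<in>F. Poly_Mapping.single m (Poly_Mapping.lookup P m)) \<subseteq> S"
    if "finite F" "F \<subseteq> S" for F
    using that
  proof (induction F)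
    case empty
    then show ?case by (simp add: zero)
  next
    case (insert m F)
    then show ?case
      using add[of m "\<Sum>m\<in>F. Poly_Mapping.single m (Poly_Mapping.lookup P m)" "Poly_Mapping.lookup P m"]
        keys_add[of "Poly_Mapping.single m (Poly_Mapping.lookup P m)"
          "\<Sum>m\<in>F. Poly_Mapping.single m (Poly_Mapping.lookup P m)"]
      by (auto split: if_splits)
  qed
  moreover have "(\<Sum>m\<in>Poly_Mapping.keys P. Poly_Mapping.single m (Poly_Mapping.lookup P m)) = P"
    by (rule poly_mapping_eqI)
      (auto simp: lookup_sum lookup_single when_def in_keys_iff)
  ultimately show ?thesis
    using assms(1) by (metis finite_keys)
qed

text \<open>Both algebras are images of such maps: with \<open>\<mu> m\<close> the monomial of
  exponent \<open>m\<close> this is the identity, and with the transported monomial it is the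
  isomorphism.\<close>

definition lin_ext :: "(complex \<Rightarrow> 'r::comm_ring_1) \<Rightarrow> ('m \<Rightarrow> 'r) \<Rightarrow> ('m \<Rightarrow>\<^sub>0 complex) \<Rightarrow> 'r" where
  "lin_ext emb \<mu> P = (\<Sum>m\<in>Poly_Mapping.keys P. emb (Poly_Mapping.lookup P m) * \<mu> m)"

text \<open>\<open>\<mu>\<close> is multiplicative only on \<open>S\<close>: the exponent map used
  later rests on a choice of words and has a meaning only for products of generators. Hence the
  product rule for \<open>lin_ext\<close> carries conditions on keys.\<close>

locale monoid_rep =
  fixes emb :: "complex \<Rightarrow> 'r::comm_ring_1" and \<mu> :: "'m::comm_monoid_add \<Rightarrow> 'r" and S :: "'m set"
  assumes emb_1: "emb 1 = 1"
    and emb_add: "emb (x + y) = emb x + emb y"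
    and emb_mult: "emb (x * y) = emb x * emb y"
    and zero_mem: "0 \<in> S"
    and add_mem: "a \<in> S \<Longrightarrow> b \<in> S \<Longrightarrow> a + b \<in> S"
    and \<mu>_0: "\<mu> 0 = 1"
    and \<mu>_add: "a \<in> S \<Longrightarrow> b \<in> S \<Longrightarrow> \<mu> (a + b) = \<mu> a * \<mu> b"
begin

lemma emb_0: "emb 0 = 0"
  using emb_add[of 0 0] by simp

lemma lin_ext_superset:
  assumes "finite F" "Poly_Mapping.keys P \<subseteq> F"
  shows "lin_ext emb \<mu> P = (\<Sum>m\<in>F. emb (Poly_Mapping.lookup P m) * \<mu> m)"
  unfolding lin_ext_def
  by (rule sum.mono_neutral_left) (use assms in \<open>auto simp: in_keys_iff emb_0\<close>)

lemma lin_ext_0: "lin_ext emb \<mu> 0 = 0"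
  by (simp add: lin_ext_def)

lemma lin_ext_single: "lin_ext emb \<mu> (Poly_Mapping.single m c) = emb c * \<mu> m"
  by (simp add: lin_ext_def emb_0)

lemma lin_ext_const: "lin_ext emb \<mu> (Poly_Mapping.single 0 c) = emb c"
  by (simp add: lin_ext_single \<mu>_0)

lemma lin_ext_add: "lin_ext emb \<mu> (P + Q) = lin_ext emb \<mu> P + lin_ext emb \<mu> Q"
proof -
  let ?F = "Poly_Mapping.keys P \<union> Poly_Mapping.keys Q"
  have "lin_ext emb \<mu> (P + Q) = (\<Sum>m\<in>?F. emb (Poly_Mapping.lookup (P + Q) m) * \<mu> m)"
    by (rule lin_ext_superset) (use keys_add[of P Q] in auto)
  also have "\<dots> = lin_ext emb \<mu> P + lin_ext emb \<mu> Q"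
    by (simp add: lin_ext_superset[of ?F] lookup_add emb_add distrib_right sum.distrib)
  finally show ?thesis .
qed

lemma lin_ext_single_mult:
  assumes "m \<in> S" "Poly_Mapping.keys Q \<subseteq> S"
  shows "lin_ext emb \<mu> (Poly_Mapping.single m c * Q) = emb c * \<mu> m * lin_ext emb \<mu> Q"
  using assms(2)
proof (induction Q rule: poly_mapping_keys_induct)
  case zero
  then show ?case by (simp add: lin_ext_0)
next
  case (add m' c' R)
  then show ?case
    using assms(1)
    by (simp add: distrib_left lin_ext_add mult_single lin_ext_single emb_mult \<mu>_add mult.assoc mult.left_commute)
qed

lemma lin_ext_mult:
  assumes "Poly_Mapping.keys P \<subseteq> S" "Poly_Mapping.keys Q \<subseteq> S"
  shows "lin_ext emb \<mu> (P * Q) = lin_ext emb \<mu> P * lin_ext emb \<mu> Q"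
  using assms(1)
proof (induction P rule: poly_mapping_keys_induct)
  case zero
  then show ?case by (simp add: lin_ext_0)
next
  case (add m c R)
  then show ?case
    using assms(2)
    by (simp add: distrib_right lin_ext_add lin_ext_single lin_ext_single_mult)
qed

lemma keys_mult_subset:
  fixes P Q :: "'m \<Rightarrow>\<^sub>0 complex"
  assumes "Poly_Mapping.keys P \<subseteq> S" "Poly_Mapping.keys Q \<subseteq> S"
  shows "Poly_Mapping.keys (P * Q) \<subseteq> S"
  using keys_mult[of P Q] assms add_mem by blast

text \<open>The generators may differ from the monomials \<open>\<mu> (u g)\<close> by scalars in
  either direction, which absorbs the signs of the initial terms. The right-hand side is itself a
  subalgebra containing \<open>X\<close>; conversely every exponent in \<open>S\<close> is a word,
  so its monomial is a product of generators.\<close>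

lemma generated_subalgebra_eq:
  assumes S: "S = {sum_list (map u ws) |ws. ws \<in> lists G}"
    and X: "\<And>x. x \<in> X \<Longrightarrow> \<exists>c. \<exists>g\<in>G. x = emb c * \<mu> (u g)"
    and G: "\<And>g. g \<in> G \<Longrightarrow> \<exists>c. \<exists>x\<in>X. \<mu> (u g) = emb c * x"
  shows "generated_subalgebra emb X = lin_ext emb \<mu> ` {P. Poly_Mapping.keys P \<subseteq> S}" (is "_ = ?R")
proof
  have u_mem: "u g \<in> S" if "g \<in> G" for g
  proof -
    have "u g = sum_list (map u [g])" "[g] \<in> lists G" using that by auto
    then show ?thesis unfolding S by blast
  qed
  show "generated_subalgebra emb X \<subseteq> ?R"
    unfolding generated_subalgebra_def
  proof (rule hull_minimal)
    show "X \<subseteq> ?R"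
    proof
      fix x assume "x \<in> X"
      then obtain c g where "g \<in> G" "x = emb c * \<mu> (u g)" using X by blast
      then have "x = lin_ext emb \<mu> (Poly_Mapping.single (u g) c)"
        "Poly_Mapping.keys (Poly_Mapping.single (u g) c) \<subseteq> S"
        using u_mem by (auto simp: lin_ext_single)
      then show "x \<in> ?R" by blast
    qed
    have "emb c \<in> ?R" for c
      using lin_ext_const[of c, symmetric] by (rule image_eqI) (auto simp: zero_mem)
    moreover have "lin_ext emb \<mu> P + lin_ext emb \<mu> Q \<in> ?R"
      if "Poly_Mapping.keys P \<subseteq> S" "Poly_Mapping.keys Q \<subseteq> S" for P Q
      using lin_ext_add[of P Q, symmetric] by (rule image_eqI) (use that keys_add[of P Q] in auto)
    moreover have "lin_ext emb \<mu> P * lin_ext emb \<mu> Q \<in> ?R"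
      if "Poly_Mapping.keys P \<subseteq> S" "Poly_Mapping.keys Q \<subseteq> S" for P Q
      using lin_ext_mult[OF that, symmetric] by (rule image_eqI) (use keys_mult_subset[OF that] in auto)
    ultimately show "is_subalgebra emb ?R"
      unfolding is_subalgebra_def by auto
  qed
  let ?A = "generated_subalgebra emb X"
  have A_const: "emb c \<in> ?A" and A_add: "x \<in> ?A \<Longrightarrow> y \<in> ?A \<Longrightarrow> x + y \<in> ?A"
    and A_mult: "x \<in> ?A \<Longrightarrow> y \<in> ?A \<Longrightarrow> x * y \<in> ?A" for c x y
    using is_subalgebra_generated[of emb X] unfolding is_subalgebra_def by auto
  have X_mem: "x \<in> ?A" if "x \<in> X" for x
    unfolding generated_subalgebra_def using that hull_inc by metis
  have gen_mem: "\<mu> (u g) \<in> ?A" if "g \<in> G" for g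
    using G[OF that] A_mult A_const X_mem by metis
  have word_mem: "\<mu> (sum_list (map u ws)) \<in> ?A" if "ws \<in> lists G" for ws
    using that
  proof (induction ws)
    case Nil
    then show ?case using A_const[of 1] by (simp add: \<mu>_0 emb_1)
  next
    case (Cons g ws)
    moreover have "sum_list (map u ws) \<in> S" using Cons unfolding S by blast
    ultimately show ?case
      by (simp add: \<mu>_add u_mem A_mult gen_mem)
  qed
  show "?R \<subseteq> ?A"
  proof safe
    fix P :: "'m \<Rightarrow>\<^sub>0 complex"
    assume "Poly_Mapping.keys P \<subseteq> S"
    then show "lin_ext emb \<mu> P \<in> ?A"
    proof (induction P rule: poly_mapping_keys_induct)
      case zero
      then show ?case using A_const[of 0] by (simp add: lin_ext_0 emb_0)
    next
      case (add m c R)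
      obtain ws where "ws \<in> lists G" "m = sum_list (map u ws)"
        using add(1) unfolding S by blast
      with word_mem have "\<mu> m \<in> ?A" by blast
      then show ?case
        using add A_const A_mult A_add by (simp add: lin_ext_add lin_ext_single)
    qed
  qed
qed

end

lemma cpoly_const_1: "cpoly_const 1 = 1"
  and cpoly_const_add: "cpoly_const (x + y) = cpoly_const x + cpoly_const y"
  and cpoly_const_mult: "cpoly_const (x * y) = cpoly_const x * cpoly_const y"
  by (simp_all add: cpoly_const_def single_add mult_single)

lemma lin_ext_id: "lin_ext cpoly_const (\<lambda>m. Poly_Mapping.single m 1) P = P"
  unfolding lin_ext_def cpoly_const_def mult_single
  by (rule poly_mapping_eqI) (auto simp: lookup_sum lookup_single when_def in_keys_iff)

section \<open>Isomorphisms of graded monomial algebras\<close>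

lemma lookup_coeff_lin_ext:
  "Poly_Mapping.lookup (coeff (lin_ext ys_const (\<lambda>m. monom (Poly_Mapping.single (w m) 1) (d m)) P) e) v =
     (\<Sum>m\<in>Poly_Mapping.keys P. if d m = e \<and> w m = v then Poly_Mapping.lookup P m else 0)"
  unfolding lin_ext_def ys_const_def cpoly_const_def
  by (auto simp: coeff_sum lookup_sum lookup_single when_def mult_single smult_monom
      intro!: sum.cong)

text \<open>Monomials are linearly independent, so a bijective homomorphism of exponent monoids is
  enough: \<open>d\<close> and \<open>w\<close> are additive and jointly injective on
  \<open>S\<close>. The scalars allowed for \<open>X\<close> are the signs; \<open>Y\<close>
  consists of genuine monomials.\<close>

theorem monomial_algebra_iso:
  fixes u :: "'g \<Rightarrow> 'v monomial" and w :: "'v monomial \<Rightarrow> qelt monomial" and d :: "'v monomial \<Rightarrow> nat"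
  assumes S: "S = {sum_list (map u ws) |ws. ws \<in> lists G}"
    and add: "\<And>a b. a \<in> S \<Longrightarrow> b \<in> S \<Longrightarrow> d (a + b) = d a + d b \<and> w (a + b) = w a + w b"
    and inj: "\<And>a b. a \<in> S \<Longrightarrow> b \<in> S \<Longrightarrow> d a = d b \<Longrightarrow> w a = w b \<Longrightarrow> a = b"
    and deg: "\<And>a. a \<in> S \<Longrightarrow> mdegree a = p * d a" and "p > 0"
    and X: "\<And>x. x \<in> X \<Longrightarrow> \<exists>c. \<exists>g\<in>G. x = cpoly_const c * Poly_Mapping.single (u g) 1"
    and X': "\<And>g. g \<in> G \<Longrightarrow> \<exists>c. \<exists>x\<in>X. Poly_Mapping.single (u g) 1 = cpoly_const c * x"
    and Y: "Y = (\<lambda>g. monom (Poly_Mapping.single (w (u g)) 1) (d (u g))) ` G"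
  defines "A \<equiv> generated_subalgebra cpoly_const X"
    and "B \<equiv> generated_subalgebra ys_const Y"
    and "f \<equiv> lin_ext ys_const (\<lambda>m. monom (Poly_Mapping.single (w m) 1) (d m))"
  shows "graded_algebra_iso
      cpoly_const A (\<lambda>e. {P \<in> A. \<forall>m\<in>Poly_Mapping.keys P. mdegree m = p * e})
      ys_const B (\<lambda>e. {g \<in> B. \<forall>e'. e' \<noteq> e \<longrightarrow> coeff g e' = 0}) f"
proof -
  have S_0: "0 \<in> S" unfolding S by (force intro: exI[of _ "[]"])
  have S_add: "a + b \<in> S" if ab: "a \<in> S" "b \<in> S" for a b
  proof -
    obtain ws ws' where "ws \<in> lists G" "a = sum_list (map u ws)" "ws' \<in> lists G" "b = sum_list (map u ws')"
      using ab unfolding S by blast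
    then have "a + b = sum_list (map u (ws @ ws'))" "ws @ ws' \<in> lists G" by auto
    then show ?thesis unfolding S by blast
  qed
  have dw_0: "d 0 = 0" "w 0 = 0"
    using add[OF S_0 S_0] by auto
  interpret A: monoid_rep cpoly_const "\<lambda>m. Poly_Mapping.single m 1" S
    by unfold_locales (simp_all add: cpoly_const_1 cpoly_const_add cpoly_const_mult S_0 S_add mult_single)
  interpret B: monoid_rep ys_const "\<lambda>m. monom (Poly_Mapping.single (w m) 1) (d m)" S
    by unfold_locales
      (simp_all add: ys_const_def cpoly_const_1 cpoly_const_add cpoly_const_mult S_0 S_add add dw_0
        mult_monom mult_single one_poly_eq_simps monom_0)
  have A_eq: "A = {P. Poly_Mapping.keys P \<subseteq> S}"
    unfolding A_def by (subst A.generated_subalgebra_eq[OF S X X']) (auto simp: lin_ext_id)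
  have B_eq: "B = f ` {P. Poly_Mapping.keys P \<subseteq> S}"
    unfolding B_def f_def
  proof (rule B.generated_subalgebra_eq[OF S])
    show "\<exists>c. \<exists>g\<in>G. x = ys_const c * monom (Poly_Mapping.single (w (u g)) 1) (d (u g))" if "x \<in> Y" for x
      using that unfolding Y by (intro exI[of _ 1]) (auto simp: B.emb_1)
    show "\<exists>c. \<exists>x\<in>Y. monom (Poly_Mapping.single (w (u g)) 1) (d (u g)) = ys_const c * x" if "g \<in> G" for g
      using that unfolding Y by (intro exI[of _ 1]) (auto simp: B.emb_1)
  qed
  \<comment> \<open>Joint injectivity leaves a single summand, so each coefficient of
    \<open>P\<close> can be read off its image.\<close>
  have lookup_f: "Poly_Mapping.lookup (coeff (f P) (d m)) (w m) = Poly_Mapping.lookup P m"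
    if "Poly_Mapping.keys P \<subseteq> S" "m \<in> S" for P m
  proof -
    have "Poly_Mapping.lookup (coeff (f P) (d m)) (w m) =
        (\<Sum>m'\<in>Poly_Mapping.keys P. if m' = m then Poly_Mapping.lookup P m else 0)"
      unfolding f_def lookup_coeff_lin_ext using that inj by (intro sum.cong) auto
    then show ?thesis by (simp add: in_keys_iff)
  qed
  have "inj_on f A"
  proof
    fix P Q assume PQ: "P \<in> A" "Q \<in> A" "f P = f Q"
    show "P = Q"
    proof (rule poly_mapping_eqI)
      fix m
      show "Poly_Mapping.lookup P m = Poly_Mapping.lookup Q m"
      proof (cases "m \<in> S")
        case True
        then show ?thesis using lookup_f[of P m] lookup_f[of Q m] PQ unfolding A_eq by simp
      next
        case False
        then have "m \<notin> Poly_Mapping.keys P" "m \<notin> Poly_Mapping.keys Q" using PQ unfolding A_eq by auto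
        then show ?thesis by (simp add: in_keys_iff)
      qed
    qed
  qed
  then have "bij_betw f A B"
    unfolding bij_betw_def A_eq B_eq by blast
  moreover have "(\<forall>m\<in>Poly_Mapping.keys P. mdegree m = p * e) \<longleftrightarrow> (\<forall>e'. e' \<noteq> e \<longrightarrow> coeff (f P) e' = 0)"
    if "P \<in> A" for P e
  proof -
    have P: "Poly_Mapping.keys P \<subseteq> S" using that unfolding A_eq by auto
    \<comment> \<open>Since \<open>p > 0\<close>, the total degree determines \<open>d\<close>, and
      both gradings select the same keys.\<close>
    have deg_iff: "mdegree m = p * e \<longleftrightarrow> d m = e" if "m \<in> Poly_Mapping.keys P" for m
      using deg[of m] P that \<open>p > 0\<close> by auto
    show ?thesis
    proof safe
      fix e' assume h: "\<forall>m\<in>Poly_Mapping.keys P. mdegree m = p * e" "e' \<noteq> e"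
      show "coeff (f P) e' = 0"
        by (rule poly_mapping_eqI)
          (use h deg_iff in \<open>auto simp: f_def lookup_coeff_lin_ext intro!: sum.neutral\<close>)
    next
      fix m assume h: "\<forall>e'. e' \<noteq> e \<longrightarrow> coeff (f P) e' = 0" and m: "m \<in> Poly_Mapping.keys P"
      show "mdegree m = p * e"
      proof (rule ccontr)
        assume "mdegree m \<noteq> p * e"
        then have "coeff (f P) (d m) = 0" using h deg_iff[OF m] by auto
        then show False using lookup_f[of P m] m P by (auto simp: in_keys_iff)
      qed
    qed
  qed
  ultimately show ?thesis
    unfolding graded_algebra_iso_def
    using B.lin_ext_const B.lin_ext_add B.lin_ext_mult
    by (auto simp: f_def[symmetric] A_eq B_eq cpoly_const_def image_iff)
qed

section \<open>Cell coordinates for the variables\<close>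

definition zcell :: "nat \<Rightarrow> nat \<Rightarrow> qelt \<Rightarrow> zvar" where
  "zcell p n = (\<lambda>(a, b). (nat ((a - 1) mod int p) + 1, rmod b n, nat ((a - 1) div int p)))"

definition cell_space :: "nat \<Rightarrow> qelt set" where
  "cell_space n = {(a, b). 1 \<le> a \<and> a \<le> b \<and> b < a + int n}"

lemma rmod_range: "n > 0 \<Longrightarrow> rmod a n \<in> {1..int n}"
  by (simp add: rmod_def add1_zle_eq pos_mod_bound)

lemma rmod_eq_self: "a \<in> {1..int n} \<Longrightarrow> rmod a n = a"
  by (simp add: rmod_def)

lemma rmod_diff_mod: "(rmod a n - rmod b n) mod int n = (a - b) mod int n"
  by (simp add: rmod_def mod_diff_eq)

lemma rmod_add_mod: "rmod (a + (b - a) mod int n) n = rmod b n"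
proof -
  have "(a + (b - a) mod int n - 1) mod int n = ((a - 1) + (b - a) mod int n) mod int n"
    by (simp add: algebra_simps)
  also have "\<dots> = ((a - 1) + (b - a)) mod int n" by (simp add: mod_add_right_eq)
  finally show ?thesis by (simp add: rmod_def)
qed

lemma zcell_zvars:
  assumes "1 \<le> p" "0 < n"
  shows "zcell p n q \<in> zvars p n"
proof -
  obtain a b where q: "q = (a, b)" by (cases q)
  have "nat ((a - 1) mod int p) < p" using assms by (simp add: nat_less_iff)
  then show ?thesis
    using rmod_range[OF assms(2), of b] by (simp add: zcell_def zvars_def q)
qed

text \<open>\<open>t + (j - t) mod int n\<close> is the only lift of the column \<open>j\<close> to
  the window of \<open>n\<close> integers starting at \<open>t\<close>.\<close>

lemma zcell_time:
  assumes "1 \<le> t" "\<sigma> < p" "t = int p * int \<kappa> + int \<sigma> + 1" "j \<in> {1..int n}"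
  shows "zcell p n (t, t + (j - t) mod int n) = (\<sigma> + 1, j, \<kappa>)"
proof -
  have "(t - 1) mod int p = int \<sigma>" "(t - 1) div int p = int \<kappa>"
    using assms by (simp_all add: div_add1_eq)
  then show ?thesis
    using assms(4) by (simp add: zcell_def rmod_add_mod rmod_eq_self)
qed

lemma zvars_zcell:
  assumes "1 \<le> p" "0 < n" "z \<in> zvars p n"
  obtains q where "q \<in> cell_space n" "z = zcell p n q"
proof -
  obtain i j \<kappa> where z: "z = (i, j, \<kappa>)" by (cases z)
  define t where "t = int p * int \<kappa> + int (i - 1) + 1"
  have "0 \<le> int p * int \<kappa>" by simp
  then have "t \<ge> 1" unfolding t_def by linarith
  moreover have "i - 1 < p" "j \<in> {1..int n}" "i \<ge> 1"
    using assms unfolding z zvars_def by auto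
  ultimately have "z = zcell p n (t, t + (j - t) mod int n)"
    using zcell_time[of t "i - 1" p \<kappa> j n] by (simp add: z t_def)
  moreover have "(t, t + (j - t) mod int n) \<in> cell_space n"
    using \<open>t \<ge> 1\<close> \<open>0 < n\<close> by (simp add: cell_space_def)
  ultimately show ?thesis by (rule that[rotated])
qed

text \<open>The cyclic sequence of columns belonging to \<open>a\<close> starts at \<open>a\<close>
  modulo \<open>n\<close>, because \<open>a\<close> is exactly the number \<open>kp + i\<close> in
  the definition of the order. So the position of the column of \<open>b\<close> is
  \<open>b - a\<close>, and comparing positions is comparing \<open>b\<close>.\<close>

lemma zcell_before:
  assumes p: "1 \<le> p" and q: "q \<in> cell_space n" and q': "q' \<in> cell_space n"
  shows "pbw_before p n (zcell p n q) (zcell p n q') \<longleftrightarrow>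
    fst q < fst q' \<or> fst q = fst q' \<and> snd q < snd q'"
proof -
  obtain a b a' b' where [simp]: "q = (a, b)" "q' = (a', b')" by (cases q, cases q')
  have ab: "1 \<le> a" "a \<le> b" "b < a + int n" "1 \<le> a'" "a' \<le> b'" "b' < a' + int n"
    using q q' by (auto simp: cell_space_def)
  define r \<kappa> r' \<kappa>' where "r = nat ((a - 1) mod int p)" and "\<kappa> = nat ((a - 1) div int p)"
    and "r' = nat ((a' - 1) mod int p)" and "\<kappa>' = nat ((a' - 1) div int p)"
  have r: "r < p" "r' < p" using p by (simp_all add: r_def r'_def nat_less_iff)
  have a: "a = int \<kappa> * int p + int (r + 1)" and a': "a' = int \<kappa>' * int p + int (r' + 1)"
    using ab p by (simp_all add: r_def \<kappa>_def r'_def \<kappa>'_def pos_imp_zdiv_nonneg_iff)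
  have less: "m * int p + int (s + 1) < m' * int p + int (s' + 1)" if "m < m'" "s < p" for m m' s s'
  proof -
    have "(m + 1) * int p \<le> m' * int p" using that by (intro mult_right_mono) auto
    then show ?thesis using that by (simp add: algebra_simps)
  qed
  have lex: "a < a' \<longleftrightarrow> \<kappa> < \<kappa>' \<or> \<kappa> = \<kappa>' \<and> r < r'"
    using less[of "int \<kappa>" "int \<kappa>'" r r'] less[of "int \<kappa>'" "int \<kappa>" r' r] r unfolding a a'
    by (cases \<kappa> \<kappa>' rule: linorder_cases) auto
  have lex_eq: "a = a' \<longleftrightarrow> \<kappa> = \<kappa>' \<and> r = r'"
    using less[of "int \<kappa>" "int \<kappa>'" r r'] less[of "int \<kappa>'" "int \<kappa>" r' r] r unfolding a a'
    by (cases \<kappa> \<kappa>' rule: linorder_cases) auto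
  have pos: "(rmod x n - rmod (int \<kappa> * int p + int (r + 1)) n) mod int n = x - a"
    if "a \<le> x" "x < a + int n" for x
    unfolding a[symmetric] rmod_diff_mod using that by simp
  have "zcell p n q = (r + 1, rmod b n, \<kappa>)" "zcell p n q' = (r' + 1, rmod b' n, \<kappa>')"
    by (simp_all add: zcell_def r_def \<kappa>_def r'_def \<kappa>'_def)
  then have "pbw_before p n (zcell p n q) (zcell p n q') \<longleftrightarrow>
      \<kappa> < \<kappa>' \<or> \<kappa> = \<kappa>' \<and> (r < r' \<or> r = r' \<and>
        (rmod b n - rmod (int \<kappa> * int p + int (r + 1)) n) mod int n
          < (rmod b' n - rmod (int \<kappa> * int p + int (r + 1)) n) mod int n)"
    by (simp add: pbw_before_def Let_def)
  then show ?thesis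
    using lex lex_eq pos[of b] pos[of b'] ab by auto
qed

lemma zcell_inj: "1 \<le> p \<Longrightarrow> inj_on (zcell p n) (cell_space n)"
proof
  fix q q' assume p: "1 \<le> p" and q: "q \<in> cell_space n" "q' \<in> cell_space n" "zcell p n q = zcell p n q'"
  have "\<not> pbw_before p n z z" for z by (auto simp: pbw_before_def Let_def)
  then have "\<not> (fst q < fst q' \<or> fst q = fst q' \<and> snd q < snd q')"
    "\<not> (fst q' < fst q \<or> fst q' = fst q \<and> snd q' < snd q)"
    using zcell_before[OF p] q by metis+
  then show "q = q'" by (auto intro!: prod_eqI)
qed

text \<open>This is what makes the maximal monomial in \<open>initial_term\<close> unique. If both
  comparisons held in equal degree, their two witnesses would be distinct variables, and the earlier
  one would force equal exponents at the later one.\<close>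

lemma pbw_less_asym:
  assumes p: "1 \<le> p" "0 < n" and ab: "pbw_less p n a b" "pbw_less p n b a"
  shows False
proof -
  have "mdegree a \<le> mdegree b" "mdegree b \<le> mdegree a"
    using ab unfolding pbw_less_def degrevlex_less_def by (elim disjE conjE; simp)+
  then have deg: "mdegree a = mdegree b" by simp
  obtain x where x: "x \<in> zvars p n" "Poly_Mapping.lookup a x > Poly_Mapping.lookup b x"
      "\<And>y. y \<in> zvars p n \<Longrightarrow> pbw_before p n x y \<Longrightarrow> Poly_Mapping.lookup a y = Poly_Mapping.lookup b y"
    using ab(1) unfolding pbw_less_def degrevlex_less_def deg by blast
  obtain y where y: "y \<in> zvars p n" "Poly_Mapping.lookup b y > Poly_Mapping.lookup a y"
      "\<And>x. x \<in> zvars p n \<Longrightarrow> pbw_before p n y x \<Longrightarrow> Poly_Mapping.lookup b x = Poly_Mapping.lookup a x"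
    using ab(2) unfolding pbw_less_def degrevlex_less_def deg by blast
  obtain q q' where q: "q \<in> cell_space n" "x = zcell p n q" "q' \<in> cell_space n" "y = zcell p n q'"
    using zvars_zcell[OF p x(1)] zvars_zcell[OF p y(1)] by metis
  have "x \<noteq> y" using x(2) y(2) by (metis less_asym)
  then have "fst q \<noteq> fst q' \<or> snd q \<noteq> snd q'" unfolding q by (metis prod_eqI)
  then have "pbw_before p n x y \<or> pbw_before p n y x"
    using zcell_before[OF p(1) q(1) q(3)] zcell_before[OF p(1) q(3) q(1)] unfolding q by linarith
  then show False using x(3)[OF y(1)] y(3)[OF x(1)] x(2) y(2) by (metis less_irrefl)
qed

section \<open>Squarefree monomials\<close>

definition set_monomial :: "'v set \<Rightarrow> 'v monomial" where
  "set_monomial B = (\<Sum>b\<in>B. Poly_Mapping.single b 1)"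

lemma lookup_set_monomial: "finite B \<Longrightarrow> Poly_Mapping.lookup (set_monomial B) x = of_bool (x \<in> B)"
  by (simp add: set_monomial_def lookup_sum lookup_single when_def)

lemma keys_set_monomial: "finite B \<Longrightarrow> Poly_Mapping.keys (set_monomial B) = B"
  by (auto simp: in_keys_iff lookup_set_monomial)

lemma mdegree_set_monomial: "finite B \<Longrightarrow> mdegree (set_monomial B) = card B"
  by (simp add: mdegree_def keys_set_monomial lookup_set_monomial)

lemma prod_cpoly_var:
  assumes "finite A"
  shows "(\<Prod>x\<in>A. cpoly_var (g x)) = Poly_Mapping.single (\<Sum>x\<in>A. Poly_Mapping.single (g x) 1) 1"
  using assms
proof (induction A)
  case (insert x A)
  show ?case
    unfolding prod.insert[OF insert(1,2)] sum.insert[OF insert(1,2)] insert.IH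
    by (simp only: cpoly_var_def mult_single mult_1)
qed simp

text \<open>\<open>x\<close> is the last cell in which the two sets differ, and reverse
  lexicographic order makes the monomial that contains it the smaller one.\<close>

lemma pbw_less_set_monomial:
  assumes p: "1 \<le> p" "0 < n" and B: "finite B" "B \<subseteq> cell_space n" and C: "finite C" "C \<subseteq> cell_space n"
    and card: "card B = card C" and x: "x \<in> B" "x \<notin> C"
    and later: "\<And>y. y \<in> B \<union> C \<Longrightarrow> fst x < fst y \<or> fst x = fst y \<and> snd x < snd y \<Longrightarrow> y \<in> B \<longleftrightarrow> y \<in> C"
  shows "pbw_less p n (set_monomial (zcell p n ` B)) (set_monomial (zcell p n ` C))"
proof -
  note inj = zcell_inj[OF p(1), of n]
  have mem: "zcell p n y \<in> zcell p n ` D \<longleftrightarrow> y \<in> D" if "y \<in> cell_space n" "D \<subseteq> cell_space n" for y D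
    using inj that by (auto dest: inj_onD)
  have "card (zcell p n ` B) = card (zcell p n ` C)"
    using card inj B C by (metis card_image inj_on_subset)
  moreover have "y \<in> zcell p n ` B \<longleftrightarrow> y \<in> zcell p n ` C"
    if y: "y \<in> zvars p n" "pbw_before p n (zcell p n x) y" for y
  proof -
    obtain q where q: "q \<in> cell_space n" "y = zcell p n q" using zvars_zcell[OF p y(1)] .
    have "fst x < fst q \<or> fst x = fst q \<and> snd x < snd q"
      using zcell_before[OF p(1), of x n q] y q x B by auto
    then have "q \<in> B \<longleftrightarrow> q \<in> C" using later by blast
    then show ?thesis using mem q B C by simp
  qed
  ultimately show ?thesis
    unfolding pbw_less_def degrevlex_less_def
  proof (intro disjI2 conjI bexI[of _ "zcell p n x"] ballI impI)
    have "x \<in> cell_space n" using B x by blast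
    then show "Poly_Mapping.lookup (set_monomial (zcell p n ` C)) (zcell p n x)
        < Poly_Mapping.lookup (set_monomial (zcell p n ` B)) (zcell p n x)"
      using mem[of x B] mem[of x C] B C x by (simp add: lookup_set_monomial)
  qed (use B C zcell_zvars[OF p] in \<open>simp_all add: mdegree_set_monomial lookup_set_monomial\<close>)
qed

text \<open>The other terms may coincide or cancel among themselves; it only matters that none of
  them shares the monomial of \<open>x0\<close>.\<close>

lemma initial_term_sum:
  fixes mon :: "'i \<Rightarrow> 'v monomial"
  assumes X: "finite X" "x0 \<in> X" and c: "c x0 \<noteq> 0"
    and lt: "\<And>x. x \<in> X \<Longrightarrow> x \<noteq> x0 \<Longrightarrow> lt (mon x) (mon x0)"
    and asym: "\<And>a b. lt a b \<Longrightarrow> lt b a \<Longrightarrow> False"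
  shows "initial_term lt (\<Sum>x\<in>X. Poly_Mapping.single (mon x) (c x)) = Poly_Mapping.single (mon x0) (c x0)"
proof -
  let ?f = "\<Sum>x\<in>X. Poly_Mapping.single (mon x) (c x)"
  have neq: "mon x \<noteq> mon x0" if "x \<in> X" "x \<noteq> x0" for x
    using lt[OF that] asym by metis
  have "Poly_Mapping.lookup ?f (mon x0) = (\<Sum>x\<in>X. if x = x0 then c x0 else 0)"
    unfolding lookup_sum lookup_single when_def by (rule sum.cong) (use neq in auto)
  then have lookup: "Poly_Mapping.lookup ?f (mon x0) = c x0" using X by simp
  then have mem: "mon x0 \<in> Poly_Mapping.keys ?f" using c by (simp add: in_keys_iff)
  have "Poly_Mapping.keys ?f \<subseteq> mon ` X"
  proof
    fix m assume "m \<in> Poly_Mapping.keys ?f"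
    then have "(\<Sum>x\<in>X. if mon x = m then c x else 0) \<noteq> 0"
      unfolding in_keys_iff lookup_sum lookup_single when_def by simp
    then have "\<not> (\<forall>x\<in>X. (if mon x = m then c x else 0) = 0)"
      using sum.neutral[of X "\<lambda>x. if mon x = m then c x else 0"] by argo
    then obtain x where "x \<in> X" "mon x = m" by metis
    then show "m \<in> mon ` X" by blast
  qed
  then have max: "lt m (mon x0)" if m: "m \<in> Poly_Mapping.keys ?f" "m \<noteq> mon x0" for m
  proof -
    obtain x where "x \<in> X" "m = mon x" using \<open>Poly_Mapping.keys ?f \<subseteq> mon ` X\<close> m(1) by blast
    then show ?thesis using lt[of x] m(2) by blast
  qed
  have "(THE m. m \<in> Poly_Mapping.keys ?f \<and> (\<forall>m'\<in>Poly_Mapping.keys ?f. m' \<noteq> m \<longrightarrow> lt m' m)) = mon x0"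
  proof (rule the_equality)
    fix m assume "m \<in> Poly_Mapping.keys ?f \<and> (\<forall>m'\<in>Poly_Mapping.keys ?f. m' \<noteq> m \<longrightarrow> lt m' m)"
    then have m: "m \<in> Poly_Mapping.keys ?f" and "mon x0 \<noteq> m \<Longrightarrow> lt (mon x0) m" using mem by blast+
    then show "m = mon x0" using max[OF m] asym by metis
  qed (use mem max in blast)
  moreover have "?f \<noteq> 0" using mem by auto
  ultimately show ?thesis
    unfolding initial_term_def using lookup by (simp add: Let_def)
qed

section \<open>The sign of a cyclic shift\<close>

text \<open>Indices from \<open>m\<close> on are fixed, so shifts of different lengths are
  permutations of the same type and can be related by composition.\<close>

definition cyclic_shift :: "nat \<Rightarrow> nat \<Rightarrow> nat" where
  "cyclic_shift m i = (if i < m then Suc i mod m else i)"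

text \<open>Each lengthening costs one transposition, which turns the sign of the cycle into an
  induction on \<open>m\<close>.\<close>

lemma cyclic_shift_Suc:
  assumes "m > 0"
  shows "cyclic_shift (Suc m) = Transposition.transpose 0 m \<circ> cyclic_shift m"
proof
  fix i
  consider "Suc i < m" | "Suc i = m" | "i = m" | "i > m" using assms by linarith
  then show "cyclic_shift (Suc m) i = (Transposition.transpose 0 m \<circ> cyclic_shift m) i"
    using assms by cases (auto simp: cyclic_shift_def Transposition.transpose_def)
qed

lemma cyclic_shift_permutes_sign:
  assumes "m > 0"
  shows "cyclic_shift m permutes {0..<m} \<and> sign (cyclic_shift m) = (-1) ^ (m - 1)"
  using assms
proof (induction m rule: nat_induct_non_zero)
  case 1
  have "cyclic_shift 1 = id" by (auto simp: cyclic_shift_def)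
  show ?case unfolding \<open>cyclic_shift 1 = id\<close> by (intro conjI permutes_id) simp
next
  case (Suc m)
  have tr: "Transposition.transpose 0 m permutes {0..<Suc m}"
    by (rule permutes_swap_id) auto
  have cs: "cyclic_shift m permutes {0..<Suc m}"
    using Suc.IH by (auto intro: permutes_subset)
  have "sign (cyclic_shift (Suc m)) = - ((-1) ^ (m - 1))"
    using Suc permutes_imp_permutation[OF _ tr] permutes_imp_permutation[OF _ cs]
    by (simp add: cyclic_shift_Suc sign_compose sign_swap_id)
  also have "\<dots> = (-1) ^ (Suc m - 1)"
    using Suc.hyps by (cases m) auto
  finally show ?case
    using permutes_compose[OF cs tr] unfolding cyclic_shift_Suc[OF Suc.hyps(1)] by blast
qed

lemma cyclic_shift_funpow:
  assumes "0 < p"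
  shows "(cyclic_shift p ^^ k) permutes {0..<p}"
    and "sign (cyclic_shift p ^^ k) = (-1) ^ ((k mod p) * (p - 1))"
    and "j < p \<Longrightarrow> (cyclic_shift p ^^ k) j = (k + j) mod p"
proof -
  note cs = cyclic_shift_permutes_sign[OF assms]
  have *: "(cyclic_shift p ^^ k) permutes {0..<p} \<and> sign (cyclic_shift p ^^ k) = (-1) ^ (k * (p - 1))"
  proof (induction k)
    case 0
    then show ?case by (simp add: permutes_id id_def[symmetric])
  next
    case (Suc k)
    have perm: "permutation (cyclic_shift p)" "permutation (cyclic_shift p ^^ k)"
      using cs Suc.IH by (auto intro: permutes_imp_permutation[of "{0..<p}"])
    have "sign (cyclic_shift p \<circ> (cyclic_shift p ^^ k)) = (-1) ^ (Suc k * (p - 1))"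
      unfolding sign_compose[OF perm] using cs Suc.IH by (simp add: power_add)
    then show ?case
      using cs Suc.IH permutes_compose[of "cyclic_shift p ^^ k" "{0..<p}" "cyclic_shift p"]
      unfolding funpow.simps by blast
  qed
  then show "(cyclic_shift p ^^ k) permutes {0..<p}" by simp
  \<comment> \<open>Parity of \<open>p * (p - 1)\<close> lets the exponent
    \<open>k * (p - 1)\<close> depend only on \<open>k mod p\<close>; this is the origin of
    \<open>r\<close> in the sign.\<close>
  have "even (p * (p - 1))" by auto
  then have "even (p * (k div p) * (p - 1))" unfolding even_mult_iff by blast
  moreover have "k * (p - 1) = (p * (k div p) + k mod p) * (p - 1)" by (simp only: mult_div_mod_eq)
  then have "k * (p - 1) = (k mod p) * (p - 1) + p * (k div p) * (p - 1)"
    by (simp only: add_mult_distrib add.commute)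
  ultimately show "sign (cyclic_shift p ^^ k) = (-1) ^ ((k mod p) * (p - 1))"
    using * by (simp only: minus_one_power_iff even_add simp_thms)
  show "(cyclic_shift p ^^ k) j = (k + j) mod p" if "j < p"
  proof (induction k)
    case (Suc k)
    have "(k + j) mod p < p" using assms by simp
    then have "cyclic_shift p ((k + j) mod p) = Suc ((k + j) mod p) mod p"
      by (simp add: cyclic_shift_def)
    also have "\<dots> = (Suc k + j) mod p" by (simp add: mod_Suc_eq)
    finally show ?case using Suc by simp
  qed (use that in simp)
qed

section \<open>Initial terms of the minors\<close>

definition cell :: "nat \<Rightarrow> int list \<Rightarrow> nat \<Rightarrow> nat \<Rightarrow> qelt" where
  "cell n I k j = (int (k + j + 1), int k + rmod (I ! j - int k) n)"

definition cells :: "nat \<Rightarrow> nat \<Rightarrow> int list \<times> nat \<Rightarrow> qelt set" where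
  "cells p n = (\<lambda>(I, k). cell n I k ` {0..<p})"

text \<open>The lower bound \<open>j + 1\<close> covers both kinds of entries: a small entry equals
  \<open>j + 1\<close> and a large one exceeds \<open>p\<close>. It keeps the cells on or above the
  diagonal. In the last part the later entry may be small, in which case the inequality is
  immediate.\<close>

lemma I_pbwD:
  assumes "(I, k) \<in> I_pbw p n"
  shows "length I = p" and "distinct I" and "set I \<subseteq> {1..int n}"
    and "j < p \<Longrightarrow> rmod (I ! j - int k) n \<in> {int j + 1..int n}"
    and "j < p \<Longrightarrow> rmod (I ! j - int k) n \<le> int p \<Longrightarrow> rmod (I ! j - int k) n = int j + 1"
    and "i < j \<Longrightarrow> j < p \<Longrightarrow> rmod (I ! i - int k) n > int p \<Longrightarrow>
      rmod (I ! j - int k) n < rmod (I ! i - int k) n"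
proof -
  let ?b = "map (\<lambda>a. rmod (a - int k) n) I"
  have I: "length I = p" "set I \<subseteq> {1..int n}" and b: "pbw_tuple p n ?b"
    using assms by (auto simp: I_pbw_def)
  have dist: "distinct ?b" and range: "set ?b \<subseteq> {1..int n}"
    using b by (auto simp: pbw_tuple_def)
  show "length I = p" "distinct I" "set I \<subseteq> {1..int n}"
    using I dist by (auto simp: distinct_map)
  have nth: "?b ! j = rmod (I ! j - int k) n" if "j < p" for j
    using that I by simp
  have low: "rmod (I ! j - int k) n = int j + 1" if "j < p" "rmod (I ! j - int k) n \<le> int p" for j
  proof -
    have "Suc j \<in> {1..p}" using that by auto
    then have "?b ! (Suc j - 1) \<le> int p \<longrightarrow> ?b ! (Suc j - 1) = int (Suc j)"
      using b unfolding pbw_tuple_def by blast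
    then show ?thesis using that nth by simp
  qed
  then show "j < p \<Longrightarrow> rmod (I ! j - int k) n \<le> int p \<Longrightarrow> rmod (I ! j - int k) n = int j + 1" .
  show "rmod (I ! j - int k) n \<in> {int j + 1..int n}" if "j < p"
  proof -
    have "?b ! j \<in> {1..int n}" using range that I by (metis length_map nth_mem subsetD)
    then show ?thesis using low[OF that] nth[OF that] that by (cases "?b ! j \<le> int p") auto
  qed
  show "rmod (I ! j - int k) n < rmod (I ! i - int k) n"
    if "i < j" "j < p" "rmod (I ! i - int k) n > int p"
  proof (cases "rmod (I ! j - int k) n > int p")
    case True
    have "Suc i \<in> {1..p}" "Suc j \<in> {1..p}" using that by auto
    then have "?b ! (Suc j - 1) > ?b ! (Suc i - 1) \<and> ?b ! (Suc i - 1) > int p \<longrightarrow> Suc j < Suc i"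
      using b unfolding pbw_tuple_def by blast
    then have "\<not> ?b ! j > ?b ! i" using that nth by simp
    moreover have "?b ! j \<noteq> ?b ! i" using dist that I nth_eq_iff_index_eq[OF dist, of j i] by simp
    ultimately show ?thesis using that nth by simp
  qed (use that in auto)
qed

lemma cells_subset: "(I, k) \<in> I_pbw p n \<Longrightarrow> cells p n (I, k) \<subseteq> cell_space n"
  using I_pbwD(4)[of I k p n] by (fastforce simp: cells_def cell_def cell_space_def)

lemma inj_cell: "inj_on (cell n I k) A"
  by (auto simp: inj_on_def cell_def)

lemma finite_cells: "finite (cells p n g)"
  by (simp add: cells_def split: prod.split)

lemma card_cells: "card (cells p n (I, k)) = p"
  by (simp add: cells_def card_image[OF inj_cell])

text \<open>\<open>t j\<close> is the first coordinate of the variable that a term of the determinant takes from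
  the column \<open>I ! j\<close>.\<close>

definition term_cell :: "nat \<Rightarrow> int list \<Rightarrow> (nat \<Rightarrow> nat) \<Rightarrow> nat \<Rightarrow> qelt" where
  "term_cell n I t j = (int (t j), int (t j) + (I ! j - int (t j)) mod int n)"

section \<open>Comparing the terms of a minor with the candidate\<close>

lemma rmod_shift_mod: "(rmod (a - c) n - d) mod int n = (a - (c + d)) mod int n"
proof -
  have "(rmod (a - c) n - d) mod int n = ((a - c - 1) mod int n - (d - 1)) mod int n"
    by (simp add: rmod_def algebra_simps)
  also have "\<dots> = (a - c - 1 - (d - 1)) mod int n" by (rule mod_diff_left_eq)
  finally show ?thesis by (simp add: algebra_simps)
qed

lemma term_cell_shift:
  assumes g: "(I, k) \<in> I_pbw p n" and j: "j < p" and tj: "t j = k + j + 1"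
  shows "term_cell n I t j = cell n I k j"
proof -
  have b: "rmod (I ! j - int k) n \<in> {int j + 1..int n}" using I_pbwD(4)[OF g j] .
  have "(I ! j - int (k + j + 1)) mod int n = (rmod (I ! j - int k) n - (int j + 1)) mod int n"
    by (simp add: rmod_shift_mod algebra_simps)
  also have "\<dots> = rmod (I ! j - int k) n - (int j + 1)"
    using b by simp
  finally show ?thesis by (simp add: term_cell_def cell_def tj)
qed

text \<open>Elements of \<open>A\<close> outside the interval are at most \<open>k\<close>, while
  the elements of the interval missing from \<open>A\<close> are at least \<open>k + 1\<close>.
  There are equally many of both and their sums agree, so there are none.\<close>

lemma top_interval_of_sum:
  fixes A :: "nat set"
  assumes A: "finite A" "card A = p" "\<And>a. a \<in> A \<Longrightarrow> a \<le> k + p"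
    and sum: "\<Sum>A = \<Sum>{k+1..k+p}"
  shows "A = {k+1..k+p}"
proof -
  let ?B = "{k+1..k+p}"
  have cardB: "card ?B = p" by simp
  have fin: "finite ?B" by simp
  have "\<Sum>A = \<Sum>(A \<inter> ?B) + \<Sum>(A - ?B)" "\<Sum>?B = \<Sum>(?B \<inter> A) + \<Sum>(?B - A)"
    using sum.Int_Diff[OF A(1), of "\<lambda>x. x" ?B] sum.Int_Diff[OF fin, of "\<lambda>x. x" A] by simp_all
  then have eq: "\<Sum>(A - ?B) = \<Sum>(?B - A)" using sum by (simp only: Int_commute[of ?B A])
  have "card A = card (A \<inter> ?B) + card (A - ?B)" "card ?B = card (?B \<inter> A) + card (?B - A)"
    using card_Int_Diff[OF A(1)] card_Int_Diff[OF fin] by blast+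
  then have card: "card (A - ?B) = card (?B - A)"
    using A(2) cardB by (simp only: Int_commute[of ?B A])
  have "\<Sum>(A - ?B) \<le> card (A - ?B) * k"
    using sum_bounded_above[of "A - ?B" "\<lambda>x. x" k] A(3) by force
  then have "\<Sum>(?B - A) \<le> card (?B - A) * k" unfolding eq card .
  moreover have "card (?B - A) * (k + 1) \<le> \<Sum>(?B - A)"
    using sum_bounded_below[of "?B - A" "k + 1" "\<lambda>x. x"] by simp
  ultimately have "card (?B - A) * (k + 1) \<le> card (?B - A) * k" by (rule order_trans[rotated])
  then have 0: "card (?B - A) = 0" by simp
  then have "?B \<subseteq> A" using fin by simp
  moreover have "A - ?B = {}" using 0 card A(1) by (metis card_0_eq finite_Diff)
  ultimately show ?thesis by blast
qed

text \<open>Because the sum is prescribed, a competing term either has a first coordinate beyond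
  \<open>k + p\<close>, and then its last cell comes after all candidate cells, or it uses the first
  coordinates \<open>k + 1, ..., k + p\<close> in another order, and then the last disagreement
  decides.\<close>

lemma term_less_initial:
  assumes g: "(I, k) \<in> I_pbw p n" and p: "1 \<le> p" and n: "0 < n"
    and t: "inj_on t {0..<p}" "\<And>j. j < p \<Longrightarrow> 1 \<le> t j"
    and sum: "(\<Sum>j<p. t j) = (\<Sum>j<p. k + j + 1)"
    and ne: "\<exists>j<p. t j \<noteq> k + j + 1"
  shows "pbw_less p n (set_monomial (zcell p n ` term_cell n I t ` {0..<p}))
    (set_monomial (zcell p n ` cells p n (I, k)))"
proof -
  let ?T = "term_cell n I t ` {0..<p}" and ?C = "cells p n (I, k)"
  have fst_T: "fst (term_cell n I t j) = int (t j)" for j by (simp add: term_cell_def)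
  have fst_T0: "fst (cell n I k j) = int (k + j + 1)" for j by (simp add: cell_def)
  have fst_T0_le: "fst y \<le> int (k + p)" if "y \<in> ?C" for y
    using that by (auto simp: cells_def cell_def)
  have T: "?T \<subseteq> cell_space n"
    using t(2) n by (force simp: term_cell_def cell_space_def)
  have "inj_on (term_cell n I t) {0..<p}"
    using t(1) by (auto simp: inj_on_def term_cell_def)
  then have card: "card ?T = card ?C" by (simp add: card_image card_cells)
  have same: "term_cell n I t j = cell n I k j" if "j < p" "t j = k + j + 1" for j
    using term_cell_shift[OF g that(1), where t = t] that(2) by blast
  have inj: "i = j" if "t i = t j" "i < p" "j < p" for i j
    using inj_onD[OF t(1) that(1)] that by simp
  have "\<exists>x\<in>?T. x \<notin> ?C \<and>
      (\<forall>y\<in>?T \<union> ?C. fst x < fst y \<or> fst x = fst y \<and> snd x < snd y \<longrightarrow> (y \<in> ?T \<longleftrightarrow> y \<in> ?C))"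
  proof (cases "\<exists>j<p. t j > k + p")
    case True
    have "finite (t ` {0..<p})" "t ` {0..<p} \<noteq> {}" using p by auto
    then have "Max (t ` {0..<p}) \<in> t ` {0..<p}" by (rule Max_in)
    then obtain j where j: "j < p" "t j = Max (t ` {0..<p})" by auto
    then have max: "t i \<le> t j" if "i < p" for i using that by simp
    have gt: "t j > k + p" using True max by (meson le_less_trans not_le)
    have x: "term_cell n I t j \<notin> ?C" using fst_T0_le[of "term_cell n I t j"] fst_T gt by auto
    have "\<not> (int (t j) < fst y \<or> int (t j) = fst y \<and> snd (term_cell n I t j) < snd y)"
      if "y \<in> ?T \<union> ?C" for y
      using that
    proof
      assume "y \<in> ?T"
      then obtain i where i: "i < p" "y = term_cell n I t i" by auto
      then show ?thesis using max[of i] inj[of i j] j by (auto simp: fst_T)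
    next
      assume "y \<in> ?C"
      then show ?thesis using fst_T0_le[of y] gt by auto
    qed
    then show ?thesis
      using j x by (intro bexI[of _ "term_cell n I t j"]) (auto simp: fst_T)
  next
    case False
    have "t ` {0..<p} = {k+1..k+p}"
    proof (rule top_interval_of_sum)
      show "card (t ` {0..<p}) = p" using t(1) by (simp add: card_image)
      show "a \<le> k + p" if "a \<in> t ` {0..<p}" for a using False that by force
      have "bij_betw (\<lambda>j. k + j + 1) {..<p} {k+1..k+p}"
        by (rule bij_betwI[of _ _ _ "\<lambda>a. a - k - 1"]) auto
      then have "(\<Sum>j<p. k + j + 1) = \<Sum>{k+1..k+p}"
        by (rule sum.reindex_bij_betw)
      then show "\<Sum>(t ` {0..<p}) = \<Sum>{k+1..k+p}"
        using sum t(1) by (simp add: sum.reindex atLeast0LessThan)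
    qed simp
    then have surj: "\<exists>i<p. t i = a" if "k + 1 \<le> a" "a \<le> k + p" for a
      using that by (metis atLeastAtMost_iff atLeastLessThan_iff imageE)
    let ?N = "{j. j < p \<and> t j \<noteq> k + j + 1}"
    have N: "finite ?N" "?N \<noteq> {}" using ne by auto
    \<comment> \<open>The last column out of place. All later columns keep their own rows, so the
      row \<open>k + j + 1\<close> must have been taken by an earlier column \<open>j'\<close>; the
      two terms are compared in this row.\<close>
    define j where "j = Max ?N"
    have "j \<in> ?N" unfolding j_def using N by (rule Max_in)
    then have j: "j < p" "t j \<noteq> k + j + 1" by auto
    have above: "t i = k + i + 1" if "i < p" "j < i" for i
    proof (rule ccontr)
      assume "t i \<noteq> k + i + 1"
      then have "i \<le> j" unfolding j_def using that N by (intro Max_ge) auto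
      then show False using that by simp
    qed
    obtain j' where j': "j' < p" "t j' = k + j + 1" using surj[of "k + j + 1"] j(1) by auto
    have "j' \<noteq> j" "\<not> j < j'" using j(2) j' above[of j'] by auto
    then have lt: "j' < j" by simp
    let ?x = "term_cell n I t j'"
    let ?b = "\<lambda>j. rmod (I ! j - int k) n"
    have fst_x: "fst ?x = int (k + j + 1)" by (simp add: fst_T j')
    have snd_x: "snd ?x > snd (cell n I k j)"
    proof -
      have "(I ! j' - int (k + j + 1)) mod int n = (?b j' - (int j + 1)) mod int n"
        by (simp add: rmod_shift_mod algebra_simps)
      moreover have "(?b j' - (int j + 1)) mod int n > ?b j - (int j + 1)"
      proof (cases "?b j' > int p")
        \<comment> \<open>A large entry lies inside the window of the row without wrapping, and the
          PBW order makes it exceed the entry of column \<open>j\<close>.\<close>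
        case True
        then have "?b j < ?b j'" using I_pbwD(6)[OF g lt j(1)] by simp
        moreover have "(?b j' - (int j + 1)) mod int n = ?b j' - (int j + 1)"
          using True j(1) I_pbwD(4)[OF g j'(1)] by simp
        ultimately show ?thesis by simp
      next
        case False
        then have b: "?b j' = int j' + 1" using I_pbwD(5)[OF g j'(1)] by simp
        have jn: "int j + 1 \<le> int n" using I_pbwD(4)[OF g j(1)] by auto
        \<comment> \<open>The small entry \<open>j' + 1\<close> lies before the window of the row
          \<open>k + j + 1\<close>, so it is lifted by \<open>n\<close>, which takes it past every
          entry in \<open>{1..n}\<close>.\<close>
        have "(?b j' - (int j + 1)) mod int n = (?b j' - (int j + 1) + int n) mod int n" by simp
        also have "\<dots> = ?b j' - (int j + 1) + int n"
          using b lt jn by (intro mod_pos_pos_trivial) auto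
        finally show ?thesis using b I_pbwD(4)[OF g j(1)] by auto
      qed
      ultimately show ?thesis using j' by (simp add: term_cell_def cell_def)
    qed
    have x: "?x \<notin> ?C"
    proof
      assume "?x \<in> ?C"
      then obtain i where i: "?x = cell n I k i" by (auto simp: cells_def)
      then have "i = j" using fst_x fst_T0[of i] by simp
      then show False using i snd_x by simp
    qed
    have "y \<in> ?T \<longleftrightarrow> y \<in> ?C"
      if y: "y \<in> ?T \<union> ?C" "fst ?x < fst y \<or> fst ?x = fst y \<and> snd ?x < snd y" for y
      using y(1)
    proof
      assume yT: "y \<in> ?T"
      then obtain i where i: "i < p" "y = term_cell n I t i" by auto
      have "t i \<noteq> k + j + 1" using y(2) i j' inj[of i j'] by auto
      then have ti: "t i > k + j + 1" using y(2) fst_x i by (auto simp: fst_T)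
      moreover have "t i \<le> k + p" using False i by force
      ultimately have "t (t i - k - 1) = t i" "t i - k - 1 < p"
        using above[of "t i - k - 1"] by auto
      then have "t i - k - 1 = i" using inj i by blast
      then have "t i = k + i + 1" using ti by linarith
      then show ?thesis using yT same[OF i(1)] i by (auto simp: cells_def)
    next
      assume yT: "y \<in> ?C"
      then obtain i where i: "i < p" "y = cell n I k i" by (auto simp: cells_def)
      have "i \<noteq> j" using y(2) i snd_x fst_x by (auto simp: fst_T0)
      then have "i > j" using y(2) i fst_x by (auto simp: fst_T0)
      then have "y = term_cell n I t i" using same[OF i(1)] above i by simp
      then show ?thesis using yT i by auto
    qed
    then show ?thesis using x j' by (intro bexI[of _ ?x]) auto
  qed
  then obtain x where "x \<in> ?T" "x \<notin> ?C"
    "\<And>y. y \<in> ?T \<union> ?C \<Longrightarrow> fst x < fst y \<or> fst x = fst y \<and> snd x < snd y \<Longrightarrow> y \<in> ?T \<longleftrightarrow> y \<in> ?C"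
    by blast
  then show ?thesis
    by (intro pbw_less_set_monomial[OF p n _ T finite_cells cells_subset[OF g] card, of x]) auto
qed

section \<open>Expanding a coefficient of a minor\<close>

definition time_of :: "nat \<Rightarrow> (nat \<Rightarrow> nat) \<times> nat multiset \<Rightarrow> nat \<Rightarrow> nat" where
  "time_of p = (\<lambda>(\<sigma>, X) j. p * count X j + \<sigma> j + 1)"

text \<open>A coefficient of a product of power series is a sum over multisets of factors:
  \<open>count X j\<close> is the superscript taken from column \<open>j\<close>, and
  \<open>\<sigma> j\<close> is its matrix row counted from 0. Distinct columns give distinct
  variables, so all monomials are squarefree.\<close>

lemma D_coeff_expand:
  assumes I: "length I = p" "distinct I" "set I \<subseteq> {1..int n}"
  shows "D_coeff p I k =
    (\<Sum>x\<in>{\<sigma>. \<sigma> permutes {0..<p}} \<times> multisets_of_size {0..<p} k.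
       Poly_Mapping.single (set_monomial (zcell p n ` term_cell n I (time_of p x) ` {0..<p})) (of_int (sign (fst x))))"
proof -
  have mono: "(\<Prod>j\<in>{0..<p}. cpoly_var (\<sigma> j + 1, I ! j, count X j)) =
      Poly_Mapping.single (set_monomial (zcell p n ` term_cell n I (time_of p (\<sigma>, X)) ` {0..<p})) 1"
    if \<sigma>: "\<sigma> permutes {0..<p}" for \<sigma> X
  proof -
    have "zcell p n (term_cell n I (time_of p (\<sigma>, X)) j) = (\<sigma> j + 1, I ! j, count X j)" if "j < p" for j
      unfolding term_cell_def
    proof (rule zcell_time)
      show "\<sigma> j < p" using permutes_in_image[OF \<sigma>, of j] that by simp
      show "I ! j \<in> {1..int n}" using I that by (metis nth_mem subsetD)
    qed (simp_all add: time_of_def)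
    then have im: "zcell p n ` term_cell n I (time_of p (\<sigma>, X)) ` {0..<p} =
        (\<lambda>j. (\<sigma> j + 1, I ! j, count X j)) ` {0..<p}"
      by (simp add: image_image)
    have "inj_on (\<lambda>j. (\<sigma> j + 1, I ! j, count X j)) {0..<p}"
      using I by (auto simp: inj_on_def nth_eq_iff_index_eq)
    then show ?thesis
      unfolding im set_monomial_def by (subst prod_cpoly_var) (simp_all add: sum.reindex)
  qed
  have Z: "Z_mat p I \<in> carrier_mat p p" by (simp add: Z_mat_def)
  have "det (Z_mat p I) = (\<Sum>\<sigma> | \<sigma> permutes {0..<p}.
      of_int (sign \<sigma>) * (\<Prod>j\<in>{0..<p}. z_series (\<sigma> j + 1) (I ! j)))"
    unfolding det_col[OF Z]
  proof (rule sum.cong)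
    fix \<sigma> assume "\<sigma> \<in> {\<sigma>. \<sigma> permutes {0..<p}}"
    then have "\<sigma> j < p" if "j < p" for j using permutes_in_image[of \<sigma> "{0..<p}" j] that by simp
    then show "of_int (sign \<sigma>) * (\<Prod>j<p. Z_mat p I $$ (\<sigma> j, j)) =
        of_int (sign \<sigma>) * (\<Prod>j\<in>{0..<p}. z_series (\<sigma> j + 1) (I ! j))"
      by (simp add: Z_mat_def atLeast0LessThan)
  qed simp
  moreover have "fps_nth (of_int (sign \<sigma>) * f) k = of_int (sign \<sigma>) * fps_nth f k"
    for \<sigma> :: "nat \<Rightarrow> nat" and f :: "zvar cpoly fps"
    by (cases \<sigma> rule: sign_cases) simp_all
  ultimately have "D_coeff p I k = (\<Sum>\<sigma> | \<sigma> permutes {0..<p}.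
      of_int (sign \<sigma>) * (\<Sum>X\<in>multisets_of_size {0..<p} k. \<Prod>j\<in>{0..<p}. cpoly_var (\<sigma> j + 1, I ! j, count X j)))"
    by (simp add: D_coeff_def fps_sum_nth fps_prod_nth' z_series_def)
  also have "\<dots> = (\<Sum>\<sigma> | \<sigma> permutes {0..<p}. \<Sum>X\<in>multisets_of_size {0..<p} k.
      Poly_Mapping.single (set_monomial (zcell p n ` term_cell n I (time_of p (\<sigma>, X)) ` {0..<p})) (of_int (sign \<sigma>)))"
    unfolding sum_distrib_left
  proof (intro sum.cong refl)
    fix \<sigma> X assume "\<sigma> \<in> {\<sigma>. \<sigma> permutes {0..<p}}"
    then show "of_int (sign \<sigma>) * (\<Prod>j\<in>{0..<p}. cpoly_var (\<sigma> j + 1, I ! j, count X j)) =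
        Poly_Mapping.single (set_monomial (zcell p n ` term_cell n I (time_of p (\<sigma>, X)) ` {0..<p})) (of_int (sign \<sigma>))"
      using mono[of \<sigma> X] by (cases \<sigma> rule: sign_cases) (simp_all add: single_uminus)
  qed
  finally show ?thesis by (simp add: sum.cartesian_product split_def)
qed

theorem in_pbw_D_eq:
  assumes g: "(I, k) \<in> I_pbw p n" and p: "1 \<le> p" and n: "0 < n"
  shows "in_pbw_D p n I k =
    Poly_Mapping.single (set_monomial (zcell p n ` cells p n (I, k))) ((-1) ^ ((k mod p) * (p - 1)))"
proof -
  let ?X = "{\<sigma>. \<sigma> permutes {0..<p}} \<times> multisets_of_size {0..<p} k"
  let ?mon = "\<lambda>x. set_monomial (zcell p n ` term_cell n I (time_of p x) ` {0..<p})"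
  \<comment> \<open>The winning term has \<open>p * count M j + \<sigma> j + 1 = k + j + 1\<close>,
    so superscript and row are quotient and remainder of \<open>k + j\<close> by \<open>p\<close>;
    the remainders form the \<open>k\<close>-th power of the cyclic shift.\<close>
  define \<sigma> where "\<sigma> = cyclic_shift p ^^ k"
  define M where "M = (\<Sum>j\<in>{0..<p}. replicate_mset ((k + j) div p) j)"
  have p0: "0 < p" using p by simp
  note \<sigma> = cyclic_shift_funpow[OF p0, where k = k, folded \<sigma>_def]
  have sum_perm: "(\<Sum>j<p. \<tau> j) = \<Sum>{..<p}" if "\<tau> permutes {0..<p}" for \<tau>
    using sum.permute[OF that, of "\<lambda>x. x"] by (simp add: atLeast0LessThan comp_def)
  have count_M: "count M j = (k + j) div p" if "j < p" for j
    using that by (simp add: M_def count_sum)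
  have time_shift: "time_of p (\<sigma>, M) j = k + j + 1" if "j < p" for j
    using that \<sigma>(3) count_M by (simp add: time_of_def)
  have size_count: "size X = (\<Sum>j<p. count X j)" if "set_mset X \<subseteq> {0..<p}" for X
    unfolding size_multiset_overloaded_eq using that
    by (intro sum.mono_neutral_left) (auto simp: not_in_iff)
  have M: "set_mset M \<subseteq> {0..<p}"
    by (auto simp: M_def set_mset_sum)
  \<comment> \<open>The remainders are a permutation of \<open>0, ..., p - 1\<close>, so after
    summation they cancel against the \<open>j\<close> and the quotients add up to
    \<open>k\<close>.\<close>
  have "(\<Sum>j<p. k + j) = p * (\<Sum>j<p. count M j) + (\<Sum>j<p. \<sigma> j)"
    unfolding sum_distrib_left sum.distrib[symmetric]
    by (rule sum.cong) (use \<sigma>(3) count_M in auto)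
  then have "p * size M = p * k"
    using sum_perm[OF \<sigma>(1)] size_count[OF M] by (auto simp: sum.distrib)
  then have "size M = k" using p0 by simp
  with M have x0: "(\<sigma>, M) \<in> ?X"
    using \<sigma>(1) by (simp add: multisets_of_size_def)
  have mon0: "?mon (\<sigma>, M) = set_monomial (zcell p n ` cells p n (I, k))"
  proof -
    have "term_cell n I (time_of p (\<sigma>, M)) ` {0..<p} = cells p n (I, k)"
      unfolding cells_def prod.case
      by (rule image_cong) (use term_cell_shift[OF g] time_shift in auto)
    then show ?thesis by simp
  qed
  have lt: "pbw_less p n (?mon x) (?mon (\<sigma>, M))" if x: "x \<in> ?X" "x \<noteq> (\<sigma>, M)" for x
    unfolding mon0
  proof (rule term_less_initial[OF g p n])
    obtain \<tau> X where x_eq: "x = (\<tau>, X)" by (cases x)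
    have \<tau>: "\<tau> permutes {0..<p}" and X: "set_mset X \<subseteq> {0..<p}" "size X = k"
      using x by (auto simp: x_eq multisets_of_size_def)
    have \<tau>_less: "\<tau> j < p" if "j < p" for j using permutes_in_image[OF \<tau>, of j] that by simp
    have time: "time_of p x j = p * count X j + \<tau> j + 1" for j by (simp add: x_eq time_of_def)
    have mod: "\<tau> j = (time_of p x j - 1) mod p" "count X j = (time_of p x j - 1) div p" if "j < p" for j
      using \<tau>_less[OF that] by (simp_all add: time)
    show "inj_on (time_of p x) {0..<p}"
    proof
      fix i j assume ij: "i \<in> {0..<p}" "j \<in> {0..<p}" "time_of p x i = time_of p x j"
      then have "\<tau> i = \<tau> j" using mod(1)[of i] mod(1)[of j] by simp
      then show "i = j" using permutes_inj[OF \<tau>] by (simp add: inj_eq)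
    qed
    show "1 \<le> time_of p x j" for j by (simp add: time)
    show "(\<Sum>j<p. time_of p x j) = (\<Sum>j<p. k + j + 1)"
    proof -
      have "(\<Sum>j<p. count X j) = k" using size_count[OF X(1)] X(2) by simp
      then show ?thesis
        using sum_perm[OF \<tau>]
        by (simp only: time sum.distrib sum_distrib_left[symmetric] sum_constant card_lessThan) simp
    qed
    \<comment> \<open>Quotient and remainder recover the multiset and the permutation on
      \<open>{0..<p}\<close>; elsewhere counts vanish and permutations are the identity.\<close>
    show "\<exists>j<p. time_of p x j \<noteq> k + j + 1"
    proof (rule ccontr)
      assume "\<not> ?thesis"
      then have "\<tau> j = (k + j) mod p \<and> count X j = (k + j) div p" if "j < p" for j
        using mod[OF that] that by simp
      then have in_range: "\<tau> j = \<sigma> j \<and> count X j = count M j" if "j < p" for j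
        using that \<sigma>(3) count_M by auto
      have out_range: "\<tau> j = \<sigma> j \<and> count X j = count M j" if "\<not> j < p" for j
      proof -
        have "j \<notin> {0..<p}" using that by simp
        then show ?thesis
          using permutes_not_in[OF \<tau>] permutes_not_in[OF \<sigma>(1)] X(1) M
          by (metis count_eq_zero_iff subsetD)
      qed
      have "\<tau> = \<sigma>" using in_range out_range by blast
      moreover have "X = M" using in_range out_range by (intro multiset_eqI) blast
      ultimately show False using x by (simp add: x_eq)
    qed
  qed
  have "in_pbw_D p n I k = Poly_Mapping.single (?mon (\<sigma>, M)) (of_int (sign (fst (\<sigma>, M))))"
    unfolding in_pbw_D_def D_coeff_expand[OF I_pbwD(1-3)[OF g]]
  proof (rule initial_term_sum)
    show "finite ?X" by (intro finite_cartesian_product finite_permutations finite_multisets_of_size) simp_all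
    show "of_int (sign (fst (\<sigma>, M))) \<noteq> (0 :: complex)" by simp
  qed (use x0 lt pbw_less_asym[OF p n] in blast)+
  then show ?thesis unfolding mon0 using \<sigma>(2) by simp
qed

section \<open>Order ideals\<close>

text \<open>The strip \<open>0 \<le> j - i < n\<close> does the work: a jump of \<open>p\<close> in
  one coordinate combined with a jump of \<open>n - p\<close> in the other, in either order, carries
  both coordinates upwards, so the first clause holds.\<close>

lemma Q_le_trans:
  assumes "Q_le p n x y" "Q_le p n y z" "x \<in> Q_poset p n" "y \<in> Q_poset p n" "z \<in> Q_poset p n"
    and "p < n"
  shows "Q_le p n x z"
proof -
  obtain i1 j1 i2 j2 i3 j3 where xyz: "x = (i1, j1)" "y = (i2, j2)" "z = (i3, j3)"
    by (cases x, cases y, cases z)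
  have Q: "i1 \<le> j1" "j1 \<le> i1 + int n - 1" "i2 \<le> j2" "j2 \<le> i2 + int n - 1" "i3 \<le> j3" "j3 \<le> i3 + int n - 1"
    using assms(3-5) by (auto simp: xyz Q_poset_def)
  have "i1 \<le> i2 \<and> j1 \<le> j2 \<or> i1 + int p \<le> i2 \<or> j1 + int n - int p \<le> j2"
    "i2 \<le> i3 \<and> j2 \<le> j3 \<or> i2 + int p \<le> i3 \<or> j2 + int n - int p \<le> j3"
    using assms(1,2) by (simp_all add: xyz Q_le_def)
  then have "i1 \<le> i3 \<and> j1 \<le> j3 \<or> i1 + int p \<le> i3 \<or> j1 + int n - int p \<le> j3"
    using Q assms(6) by (elim disjE) linarith+
  then show ?thesis by (simp add: xyz Q_le_def)
qed

lemma Q_le_antisym: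
  assumes "Q_le p n x y" "Q_le p n y x" "x \<in> Q_poset p n" "y \<in> Q_poset p n" "1 \<le> p" "p < n"
  shows "x = y"
proof -
  obtain i1 j1 i2 j2 where xy: "x = (i1, j1)" "y = (i2, j2)"
    by (cases x, cases y)
  have Q: "i1 \<le> j1" "j1 \<le> i1 + int n - 1" "i2 \<le> j2" "j2 \<le> i2 + int n - 1"
    using assms(3,4) by (auto simp: xy Q_poset_def)
  have "i1 \<le> i2 \<and> j1 \<le> j2 \<or> i1 + int p \<le> i2 \<or> j1 + int n - int p \<le> j2"
    "i2 \<le> i1 \<and> j2 \<le> j1 \<or> i2 + int p \<le> i1 \<or> j2 + int n - int p \<le> j1"
    using assms(1,2) by (simp_all add: xy Q_le_def)
  then have "i1 = i2 \<and> j1 = j2"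
    using Q assms(5,6) by (elim disjE) linarith+
  then show ?thesis by (simp add: xy)
qed

lemma Q_le_refl: "Q_le p n x x"
  by (simp add: Q_le_def split: prod.split)

definition down_set :: "nat \<Rightarrow> nat \<Rightarrow> qelt set \<Rightarrow> qelt set" where
  "down_set p n G = {q \<in> Q_poset p n. \<exists>g\<in>G. Q_le p n q g}"

lemma down_set_order_ideal:
  assumes "G \<subseteq> Q_poset p n" "finite G" "p < n"
  shows "down_set p n G \<in> order_ideals p n"
proof -
  \<comment> \<open>Each clause of \<open>Q_le\<close> bounds one coordinate and the strip bounds
    the other; \<open>a + b\<close> is a crude bound that serves all clauses.\<close>
  have "down_set p n G \<subseteq> (\<Union>(a, b)\<in>G. {1..a + b} \<times> {1..a + b + int n})"
  proof
    fix q assume "q \<in> down_set p n G"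
    then obtain i j a b where q: "q = (i, j)" "(i, j) \<in> Q_poset p n" "(a, b) \<in> G" "Q_le p n (i, j) (a, b)"
      by (cases q) (auto simp: down_set_def)
    then have "(a, b) \<in> Q_poset p n" using assms by blast
    then have "i \<in> {1..a + b}" "j \<in> {1..a + b + int n}"
      using q(2,4) by (auto simp: Q_poset_def Q_le_def)
    then show "q \<in> (\<Union>(a, b)\<in>G. {1..a + b} \<times> {1..a + b + int n})" using q by blast
  qed
  moreover have "finite (\<Union>(a, b)\<in>G. {1..a + b} \<times> {1..a + b + int n})"
    using assms(2) by auto
  ultimately have "finite (down_set p n G)" by (rule finite_subset)
  moreover have "y \<in> down_set p n G"
    if "x \<in> down_set p n G" "y \<in> Q_poset p n" "Q_le p n y x" for x y
    using that assms(1,3) Q_le_trans[of p n y x] unfolding down_set_def by blast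
  ultimately show ?thesis
    unfolding order_ideals_def by (auto simp: down_set_def)
qed

lemma hull_order_ideals:
  assumes "G \<subseteq> Q_poset p n" "finite G" "p < n"
  shows "(\<lambda>J. J \<in> order_ideals p n) hull G = down_set p n G"
proof (rule hull_unique)
  show "G \<subseteq> down_set p n G"
    using assms(1) Q_le_refl unfolding down_set_def by blast
  show "down_set p n G \<in> order_ideals p n" using assms by (rule down_set_order_ideal)
  show "down_set p n G \<subseteq> J" if "G \<subseteq> J" "J \<in> order_ideals p n" for J
    using that unfolding down_set_def order_ideals_def by auto
qed

section \<open>The ideal attached to a symbol\<close>

lemma cellsE:
  assumes "q \<in> cells p n (I, k)"
  obtains j where "j < p" "q = (int (k + j + 1), int k + rmod (I ! j - int k) n)"
  using assms by (auto simp: cells_def cell_def)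

lemma phi_pbw_eq:
  assumes g: "(I, k) \<in> I_pbw p n" and pn: "p < n"
  shows "phi_pbw p n I k = down_set p n {q \<in> cells p n (I, k). snd q > int p}"
proof -
  have "{(int k + int i, int k + rmod (I ! (i - 1) - int k) n) |i.
          i \<in> {1..p} \<and> int k + rmod (I ! (i - 1) - int k) n > int p} =
      {q \<in> cells p n (I, k). snd q > int p}" (is "?L = ?R")
  proof
    show "?L \<subseteq> ?R"
    proof
      fix q assume "q \<in> ?L"
      then obtain i where i: "i \<in> {1..p}" "q = (int k + int i, int k + rmod (I ! (i - 1) - int k) n)"
        "snd q > int p" by auto
      then have "q = cell n I k (i - 1)" "i - 1 \<in> {0..<p}" by (auto simp: cell_def)
      then show "q \<in> ?R" using i(3) unfolding cells_def by blast
    qed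
    show "?R \<subseteq> ?L"
    proof
      fix q assume "q \<in> ?R"
      then obtain j where "j < p" "q = (int (k + j + 1), int k + rmod (I ! j - int k) n)" "snd q > int p"
        by (auto elim: cellsE)
      then show "q \<in> ?L" by (auto intro!: exI[of _ "Suc j"])
    qed
  qed
  moreover have "?R \<subseteq> Q_poset p n"
    using cells_subset[OF g] by (auto simp: cell_space_def Q_poset_def)
  moreover have "finite ?R" using finite_cells by auto
  ultimately show ?thesis
    unfolding phi_pbw_def by (simp only: hull_order_ideals pn)
qed

lemma phi_pbw_order_ideal:
  assumes g: "(I, k) \<in> I_pbw p n" and pn: "p < n"
  shows "phi_pbw p n I k \<in> order_ideals p n"
  unfolding phi_pbw_eq[OF g pn]
proof (rule down_set_order_ideal)
  show "{q \<in> cells p n (I, k). snd q > int p} \<subseteq> Q_poset p n"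
    using cells_subset[OF g] by (auto simp: cell_space_def Q_poset_def)
qed (use finite_cells pn in auto)

text \<open>The cell with first coordinate \<open>k + p\<close> has second coordinate at least
  \<open>k + p\<close>, so it dominates all these diagonal elements. Conversely each of the three
  clauses, together with entries at most \<open>n\<close>, forces
  \<open>a \<le> k + p\<close>.\<close>

lemma diagonal_in_phi_pbw:
  assumes g: "(I, k) \<in> I_pbw p n" and p: "1 \<le> p" "p < n"
  shows "(a, a) \<in> phi_pbw p n I k \<longleftrightarrow> a \<in> {int p + 1..int (k + p)}"
proof
  assume "(a, a) \<in> phi_pbw p n I k"
  then obtain q where Q: "(a, a) \<in> Q_poset p n" and q: "q \<in> cells p n (I, k)" "Q_le p n (a, a) q"
    unfolding phi_pbw_eq[OF g p(2)] down_set_def by blast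
  obtain j where j: "j < p" "q = (int (k + j + 1), int k + rmod (I ! j - int k) n)"
    using q(1) by (rule cellsE)
  show "a \<in> {int p + 1..int (k + p)}"
    using Q q(2) j I_pbwD(4)[OF g j(1)] by (auto simp: Q_poset_def Q_le_def)
next
  assume a: "a \<in> {int p + 1..int (k + p)}"
  let ?q = "cell n I k (p - 1)"
  have b: "rmod (I ! (p - 1) - int k) n \<ge> int p"
    using I_pbwD(4)[OF g, of "p - 1"] p by auto
  then have "snd ?q > int p" using a by (simp add: cell_def)
  moreover have "?q \<in> cells p n (I, k)"
    unfolding cells_def prod.case using p by (intro imageI) auto
  moreover have "Q_le p n (a, a) ?q" using a b p by (auto simp: Q_le_def cell_def)
  moreover have "(a, a) \<in> Q_poset p n" using a p by (auto simp: Q_poset_def)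
  ultimately show "(a, a) \<in> phi_pbw p n I k"
    unfolding phi_pbw_eq[OF g p(2)] down_set_def by blast
qed

text \<open>A maximal element of a down-set is one of its generators. Conversely an off-diagonal
  cell has a shifted entry above \<open>p\<close>: later cells have smaller second coordinates,
  earlier ones smaller first coordinates, and the differences stay below the jumps \<open>p\<close>
  and \<open>n - p\<close>.\<close>

lemma off_diagonal_max_phi_pbw:
  assumes g: "(I, k) \<in> I_pbw p n" and p: "1 \<le> p" "p < n" and "a \<noteq> b"
  shows "(a, b) \<in> Q_max p n (phi_pbw p n I k) \<longleftrightarrow> (a, b) \<in> cells p n (I, k)"
proof
  let ?G = "{q \<in> cells p n (I, k). snd q > int p}"
  have G: "?G \<subseteq> Q_poset p n"
    using cells_subset[OF g] by (auto simp: cell_space_def Q_poset_def)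
  have G_phi: "?G \<subseteq> phi_pbw p n I k"
    using G Q_le_refl unfolding phi_pbw_eq[OF g p(2)] down_set_def by blast
  {
    assume max: "(a, b) \<in> Q_max p n (phi_pbw p n I k)"
    then obtain q where q: "q \<in> ?G" "Q_le p n (a, b) q"
      unfolding Q_max_def phi_pbw_eq[OF g p(2)] down_set_def by blast
    moreover have "q \<in> phi_pbw p n I k" using q(1) G_phi by blast
    ultimately have "q = (a, b)" using max unfolding Q_max_def by blast
    then show "(a, b) \<in> cells p n (I, k)" using q(1) by blast
  }
  assume ab: "(a, b) \<in> cells p n (I, k)"
  then obtain j where j: "j < p" "a = int (k + j + 1)" "b = int k + rmod (I ! j - int k) n"
    by (auto elim: cellsE)
  have bp: "rmod (I ! j - int k) n > int p"
    using I_pbwD(5)[OF g j(1)] j \<open>a \<noteq> b\<close> by force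
  then have abG: "(a, b) \<in> ?G" using ab j by simp
  have incomparable: "q = (a, b)" if q: "q \<in> ?G" "Q_le p n (a, b) q" for q
  proof -
    obtain i where i: "i < p" "q = (int (k + i + 1), int k + rmod (I ! i - int k) n)"
      using q(1) by (auto elim: cellsE)
    have "\<not> j < i"
      using q(2) i j bp I_pbwD(6)[OF g _ i(1), of j] I_pbwD(4)[OF g i(1)] by (auto simp: Q_le_def)
    moreover have "\<not> i < j"
      using q(2) i j bp I_pbwD(4)[OF g i(1)] by (auto simp: Q_le_def)
    ultimately have "i = j" by simp
    then show ?thesis using i j by simp
  qed
  have "q' = (a, b)" if q': "q' \<in> phi_pbw p n I k" "Q_le p n (a, b) q'" for q'
  proof -
    obtain q where Q': "q' \<in> Q_poset p n" and q: "q \<in> ?G" "Q_le p n q' q"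
      using q'(1) unfolding phi_pbw_eq[OF g p(2)] down_set_def by blast
    have "Q_le p n (a, b) q"
      using Q_le_trans[OF q'(2) q(2) _ Q' _ p(2)] abG G q(1) by blast
    then have "q = (a, b)" using incomparable q(1) by blast
    then show ?thesis using Q_le_antisym[OF q'(2) _ _ Q' p] q abG G by blast
  qed
  then show "(a, b) \<in> Q_max p n (phi_pbw p n I k)"
    using abG G_phi unfolding Q_max_def by blast
qed

lemma v_OC_phi_pbw:
  assumes g: "(I, k) \<in> I_pbw p n" and p: "1 \<le> p" "p < n"
    and Os: "Os = {q \<in> Q_poset p n. fst q = snd q}" and Cs: "Cs = Q_poset p n - Os"
  shows "v_OC p n Os Cs (phi_pbw p n I k) q =
    (if fst q = snd q then of_bool (fst q \<in> {int p + 1..int (k + p)}) else of_bool (q \<in> cells p n (I, k)))"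
proof -
  obtain a b where q: "q = (a, b)" by (cases q)
  have sub: "phi_pbw p n I k \<subseteq> Q_poset p n" "Q_max p n (phi_pbw p n I k) \<subseteq> Q_poset p n"
    unfolding Q_max_def phi_pbw_eq[OF g p(2)] down_set_def by auto
  show ?thesis
  proof (cases "a = b")
    case True
    then have "q \<in> phi_pbw p n I k \<inter> Os \<longleftrightarrow> a \<in> {int p + 1..int (k + p)}"
      "q \<notin> Q_max p n (phi_pbw p n I k) \<inter> Cs"
      using sub diagonal_in_phi_pbw[OF g p, of a] by (auto simp: q Os Cs)
    then show ?thesis using True by (simp add: v_OC_def q)
  next
    case False
    then have "q \<notin> phi_pbw p n I k \<inter> Os"
      "q \<in> Q_max p n (phi_pbw p n I k) \<inter> Cs \<longleftrightarrow> q \<in> cells p n (I, k)"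
      using sub off_diagonal_max_phi_pbw[OF g p False] by (auto simp: q Os Cs)
    then show ?thesis using False by (simp add: v_OC_def q)
  qed
qed

section \<open>Recovering a symbol from an ideal\<close>

lemma below_maximal:
  assumes J: "J \<subseteq> Q_poset p n" "finite J" and p: "1 \<le> p" "p < n" and q: "q \<in> J"
  shows "\<exists>m\<in>Q_max p n J. Q_le p n q m"
  using q
proof (induction "card {x \<in> J. Q_le p n q x}" arbitrary: q rule: less_induct)
  case less
  show ?case
  proof (cases "q \<in> Q_max p n J")
    case True
    then show ?thesis using Q_le_refl by blast
  next
    case False
    then obtain q' where q': "q' \<in> J" "Q_le p n q q'" "q' \<noteq> q"
      using less.prems unfolding Q_max_def by blast
    have up: "Q_le p n q x" if "x \<in> J" "Q_le p n q' x" for x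
      using Q_le_trans[OF q'(2) that(2) _ _ _ p(2)] J(1) less.prems q'(1) that(1) by blast
    have "\<not> Q_le p n q' q"
      using Q_le_antisym[OF q'(2) _ _ _ p] J(1) less.prems q' by blast
    then have "{x \<in> J. Q_le p n q' x} \<subset> {x \<in> J. Q_le p n q x}"
      using up less.prems Q_le_refl by blast
    then have "card {x \<in> J. Q_le p n q' x} < card {x \<in> J. Q_le p n q x}"
      using J(2) by (intro psubset_card_mono) auto
    from less.hyps[OF this q'(1)] show ?thesis
      using up unfolding Q_max_def by blast
  qed
qed

lemma rmod_rmod_diff: "rmod (rmod (c + b) n - c) n = rmod b n"
proof -
  have "(rmod (c + b) n - c - 1) mod int n = ((c + b - 1) mod int n - c) mod int n"
    by (simp add: rmod_def)
  also have "\<dots> = (c + b - 1 - c) mod int n" by (rule mod_diff_left_eq)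
  finally show ?thesis by (simp add: rmod_def)
qed

text \<open>The superscript \<open>k\<close> is the number of diagonal elements of \<open>J\<close>.
  The off-diagonal maximal elements supply the large entries, which decrease because these elements
  form an antichain; every other position gets its diagonal cell.\<close>

lemma phi_pbw_surj:
  assumes J: "J \<in> order_ideals p n" and p: "1 \<le> p" "p < n"
  obtains I k where "(I, k) \<in> I_pbw p n" "phi_pbw p n I k = J"
proof -
  have J_sub: "J \<subseteq> Q_poset p n" and J_fin: "finite J"
    and J_down: "\<And>x y. x \<in> J \<Longrightarrow> y \<in> Q_poset p n \<Longrightarrow> Q_le p n y x \<Longrightarrow> y \<in> J"
    using J by (auto simp: order_ideals_def)
  define diag :: "nat \<Rightarrow> qelt" where "diag i = (int (p + i), int (p + i))" for i
  have diag_Q: "diag (Suc i) \<in> Q_poset p n" for i using p by (simp add: diag_def Q_poset_def)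
  have "\<exists>k. diag (Suc k) \<notin> J"
  proof (rule ccontr)
    assume "\<not> ?thesis"
    then have "range (\<lambda>k. diag (Suc k)) \<subseteq> J" by blast
    moreover have "inj (\<lambda>k. diag (Suc k))" by (auto simp: inj_on_def diag_def)
    ultimately show False using J_fin finite_subset range_inj_infinite by blast
  qed
  define k where "k = (LEAST k. diag (Suc k) \<notin> J)"
  have k: "diag (Suc k) \<notin> J"
    unfolding k_def by (rule LeastI_ex) fact
  have below_k: "diag (Suc i) \<in> J" if "i < k" for i
    using not_less_Least[of i "\<lambda>k. diag (Suc k) \<notin> J"] that unfolding k_def by blast
  have above_k: "\<not> Q_le p n (diag (Suc k)) q" if "q \<in> J" for q
    using J_down[OF that diag_Q] k by blast
  have diag_iff: "(a, a) \<in> J \<longleftrightarrow> a \<in> {int p + 1..int (k + p)}" for a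
  proof
    assume aJ: "(a, a) \<in> J"
    then have "a \<ge> int p + 1" using J_sub by (auto simp: Q_poset_def)
    then show "a \<in> {int p + 1..int (k + p)}"
      using above_k[OF aJ] by (auto simp: diag_def Q_le_def)
  next
    assume a: "a \<in> {int p + 1..int (k + p)}"
    then have "(a, a) = diag (Suc (nat (a - int p - 1)))" "nat (a - int p - 1) < k"
      by (auto simp: diag_def)
    then show "(a, a) \<in> J" using below_k by metis
  qed
  define M where "M = {q \<in> Q_max p n J. fst q \<noteq> snd q}"
  have M_J: "q \<in> J" if "q \<in> M" for q using that by (auto simp: M_def Q_max_def)
  have M_antichain: "q = q'" if "q \<in> M" "q' \<in> M" "Q_le p n q q'" for q q'
    using that M_J unfolding M_def Q_max_def by blast
  \<comment> \<open>The upper bounds hold because the first missing diagonal element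
    \<open>(k + p + 1, k + p + 1)\<close> lies below nothing in \<open>J\<close>, the lower bounds
    because a maximal element does not lie below the last diagonal element
    \<open>(k + p, k + p)\<close>. For \<open>k = 0\<close> there is no such element, and the bounds
    defining the poset replace it.\<close>
  have M_range: "a \<in> {int k + 1..int k + int p} \<and> b \<in> {int k + int p + 1..int k + int n}"
    if m: "(a, b) \<in> M" for a b
  proof -
    have ab: "(a, b) \<in> Q_poset p n" "a \<noteq> b" using m M_J J_sub by (auto simp: M_def)
    have 1: "a \<le> int k + int p" "b \<le> int k + int n"
      using above_k[OF M_J[OF m]] ab by (auto simp: diag_def Q_le_def Q_poset_def)
    have 2: "a \<ge> int k + 1 \<and> b \<ge> int k + int p + 1"
    proof (cases "k = 0")
      case True
      then show ?thesis using ab by (auto simp: Q_poset_def)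
    next
      case False
      then have "(int (k + p), int (k + p)) \<in> J" using diag_iff by simp
      then have "\<not> Q_le p n (a, b) (int (k + p), int (k + p))"
        using m ab(2) unfolding M_def Q_max_def by blast
      then show ?thesis using 1 by (auto simp: Q_le_def)
    qed
    show ?thesis using 1 2 by simp
  qed
  \<comment> \<open>The choice is unambiguous, as elements with equal first coordinate are
    comparable and an antichain contains at most one of them. The default \<open>j + 1\<close>
    produces the diagonal cell.\<close>
  define B where "B j = (if \<exists>b. (int (k + j + 1), b) \<in> M then (SOME b. (int (k + j + 1), b) \<in> M) - int k
    else int j + 1)" for j :: nat
  have B_M: "B j = b - int k" if b: "(int (k + j + 1), b) \<in> M" for j b
  proof -
    have some: "(int (k + j + 1), SOME b. (int (k + j + 1), b) \<in> M) \<in> M"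
      using b by (rule someI)
    have "Q_le p n x y \<or> Q_le p n y x" if "fst x = fst y" for x y :: qelt
      using that by (cases x, cases y) (auto simp: Q_le_def)
    then have "(int (k + j + 1), SOME b. (int (k + j + 1), b) \<in> M) = (int (k + j + 1), b)"
      using M_antichain[OF some b] M_antichain[OF b some] by (metis fst_conv)
    then show ?thesis using b unfolding B_def by auto
  qed
  have B_cases: "(int (k + j + 1), int k + B j) \<in> M \<and> B j > int p \<or> B j = int j + 1" for j
  proof (cases "\<exists>b. (int (k + j + 1), b) \<in> M")
    case True
    then obtain b where b: "(int (k + j + 1), b) \<in> M" ..
    then show ?thesis using B_M[OF b] M_range[OF b] by simp
  qed (simp add: B_def)
  have B_range: "B j \<in> {1..int n}" if "j < p" for j
    using B_cases[of j] M_range[of "int (k + j + 1)" "int k + B j"] that p by auto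
  have B_anti: "B j < B i" if "i < j" "B i > int p" "j < p" for i j
  proof (cases "B j > int p")
    case True
    have "i < p" using that by simp
    then have M: "(int (k + j + 1), int k + B j) \<in> M" "(int (k + i + 1), int k + B i) \<in> M"
      using B_cases[of j] B_cases[of i] True that by auto
    show ?thesis
    proof (rule ccontr)
      assume "\<not> B j < B i"
      then have "Q_le p n (int (k + i + 1), int k + B i) (int (k + j + 1), int k + B j)"
        using that by (simp add: Q_le_def)
      then show False using M_antichain[OF M(2,1)] that by simp
    qed
  qed (use that in simp)
  define I where "I = map (\<lambda>j. rmod (int k + B j) n) [0..<p]"
  have I_B: "rmod (I ! j - int k) n = B j" if "j < p" for j
    using that B_range by (simp add: I_def rmod_rmod_diff rmod_eq_self)
  have B_inj: "i = j" if "i < p" "j < p" "B i = B j" for i j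
  proof (cases "B i > int p")
    case True
    then show ?thesis using B_anti[of i j] B_anti[of j i] that by (cases i j rule: linorder_cases) auto
  next
    case False
    then show ?thesis using B_cases[of i] B_cases[of j] that by auto
  qed
  have B_list: "map (\<lambda>a. rmod (a - int k) n) I = map B [0..<p]"
    by (rule nth_equalityI) (simp_all add: I_def rmod_rmod_diff rmod_eq_self[OF B_range])
  have g: "(I, k) \<in> I_pbw p n"
    unfolding I_pbw_def mem_Collect_eq prod.case B_list
  proof (intro conjI)
    show "length I = p" by (simp add: I_def)
    have "0 < n" using p by simp
    from rmod_range[OF this] show "set I \<subseteq> {1..int n}"
      by (force simp: I_def)
    show "pbw_tuple p n (map B [0..<p])"
      unfolding pbw_tuple_def
    proof (intro conjI ballI impI)
      show "set (map B [0..<p]) \<subseteq> {1..int n}" using B_range by force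
      show "distinct (map B [0..<p])" using B_inj by (auto simp: distinct_map inj_on_def)
    next
      fix j assume j: "j \<in> {1..p}" "map B [0..<p] ! (j - 1) \<le> int p"
      then show "map B [0..<p] ! (j - 1) = int j" using B_cases[of "j - 1"] by auto
    next
      fix j i assume ji: "j \<in> {1..p}" "i \<in> {1..p}"
        "map B [0..<p] ! (i - 1) < map B [0..<p] ! (j - 1) \<and> int p < map B [0..<p] ! (i - 1)"
      then have "B (i - 1) < B (j - 1)" "int p < B (i - 1)" by auto
      moreover have "i - 1 < j - 1" "j - 1 < p" if "\<not> j < i" "i \<noteq> j" using that ji by auto
      ultimately show "j < i"
        using B_anti[of "i - 1" "j - 1"] by force
    qed simp
  qed
  have cell: "cell n I k j = (int (k + j + 1), int k + B j)" if "j < p" for j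
    using I_B[OF that] by (simp add: cell_def)
  have "phi_pbw p n I k = J"
  proof
    have "q \<in> J" if q: "q \<in> cells p n (I, k)" "snd q > int p" for q
    proof -
      obtain j where j: "j < p" "q = (int (k + j + 1), int k + B j)"
        using q(1) cell by (auto simp: cells_def)
      show ?thesis
      proof (cases "B j = int j + 1")
        case True
        then have "q = (int (k + j + 1), int (k + j + 1))" using j by simp
        then show ?thesis using diag_iff[of "int (k + j + 1)"] q(2) j(1) by auto
      next
        case False
        then show ?thesis using B_cases[of j] j M_J by auto
      qed
    qed
    then show "phi_pbw p n I k \<subseteq> J"
      unfolding phi_pbw_eq[OF g p(2)] down_set_def using J_down by blast
    show "J \<subseteq> phi_pbw p n I k"
    proof
      fix q assume q: "q \<in> J"
      \<comment> \<open>Both sets are down-closed, so capturing the maximal elements of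
        \<open>J\<close> suffices.\<close>
      obtain m where m: "m \<in> Q_max p n J" "Q_le p n q m"
        using below_maximal[OF J_sub J_fin p q] by blast
      obtain a b where ab: "m = (a, b)" by (cases m)
      have "m \<in> phi_pbw p n I k"
      proof (cases "a = b")
        case True
        then show ?thesis
          using m(1) diag_iff[of a] diagonal_in_phi_pbw[OF g p, of a] by (simp add: ab Q_max_def)
      next
        case False
        then have mM: "(a, b) \<in> M" using m(1) by (simp add: M_def ab)
        define j where "j = nat (a - int k - 1)"
        have j: "j < p" "a = int (k + j + 1)" using M_range[OF mM] by (auto simp: j_def)
        have "(a, b) = cell n I k j" using cell[OF j(1)] B_M[of j b] mM j(2) by simp
        then have "(a, b) \<in> cells p n (I, k)" using j(1) by (auto simp: cells_def)
        then show ?thesis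
          using off_diagonal_max_phi_pbw[OF g p False] by (simp add: ab Q_max_def)
      qed
      then show "q \<in> phi_pbw p n I k"
        using phi_pbw_order_ideal[OF g p(2)] m(2) q J_sub unfolding order_ideals_def by blast
    qed
  qed
  with g show ?thesis by (rule that)
qed

section \<open>Comparing words in the generators\<close>

lemma lookup_sum_list:
  fixes f :: "'g \<Rightarrow> 'v monomial"
  shows "Poly_Mapping.lookup (sum_list (map f ws)) x = (\<Sum>g\<leftarrow>ws. Poly_Mapping.lookup (f g) x)"
  by (induction ws) (simp_all add: lookup_add)

lemma mdegree_superset:
  assumes "finite F" "Poly_Mapping.keys m \<subseteq> F"
  shows "mdegree m = (\<Sum>x\<in>F. Poly_Mapping.lookup m x)"
  unfolding mdegree_def
  by (rule sum.mono_neutral_left) (use assms in \<open>auto simp: in_keys_iff\<close>)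

lemma mdegree_add: "mdegree (a + b) = mdegree a + mdegree b"
proof -
  let ?F = "Poly_Mapping.keys a \<union> Poly_Mapping.keys b"
  have "finite ?F" by simp
  then show ?thesis
    using mdegree_superset[of ?F "a + b"] mdegree_superset[of ?F a] mdegree_superset[of ?F b] keys_add[of a b]
    by (simp add: lookup_add sum.distrib)
qed

section \<open>Multisets of superscripts from window sums and tail sums\<close>

lemma sum_list_snd_eq_mset:
  fixes f :: "'b \<Rightarrow> nat"
  shows "(\<Sum>g\<leftarrow>ws. f (snd g)) = (\<Sum>k\<in>#mset (map snd ws). f k)"
  by (induction ws) simp_all

text \<open>Exactly the superscripts from \<open>a - p\<close> to \<open>a - 1\<close> reach the row
  \<open>a\<close>; truncated subtraction cuts the window off at 0.\<close>

lemma mset_window_sum: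
  fixes M :: "nat multiset"
  shows "(\<Sum>k\<in>#M. of_bool (k < a \<and> a \<le> k + p)) = (\<Sum>m\<in>{a - p..<a}. count M m)"
proof (induction M)
  case (add k M)
  have "(\<Sum>m\<in>{a - p..<a}. if k = m then 1 else 0 :: nat) = of_bool (k < a \<and> a \<le> k + p)"
    by auto
  moreover have "(\<Sum>m\<in>{a - p..<a}. count (add_mset k M) m) =
      (\<Sum>m\<in>{a - p..<a}. if k = m then 1 else 0) + (\<Sum>m\<in>{a - p..<a}. count M m)"
    unfolding sum.distrib[symmetric] by (rule sum.cong) auto
  ultimately show ?case using add by simp
qed simp

text \<open>The window belonging to \<open>Suc m\<close> ends at \<open>m\<close>, and all its other
  members are smaller, so the multiplicities are found one after the other.\<close>

lemma mset_eq_of_window_sums: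
  fixes M N :: "nat multiset"
  assumes "1 \<le> p"
    and eq: "\<And>a. (\<Sum>k\<in>#M. of_bool (k < a \<and> a \<le> k + p)) = (\<Sum>k\<in>#N. of_bool (k < a \<and> a \<le> k + p) :: nat)"
  shows "M = N"
proof (rule multiset_eqI)
  fix m
  show "count M m = count N m"
  proof (induction m rule: less_induct)
    case (less m)
    have split: "{Suc m - p..<Suc m} = insert m {Suc m - p..<m}"
      using \<open>1 \<le> p\<close> by auto
    have "(\<Sum>i\<in>{Suc m - p..<m}. count M i) = (\<Sum>i\<in>{Suc m - p..<m}. count N i)"
      by (rule sum.cong) (use less in auto)
    then show ?case
      using eq[of "Suc m"] unfolding mset_window_sum split by simp
  qed
qed

text \<open>Consecutive tails differ by one multiplicity. Diagonal y-exponents are tails, since a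
  generator of superscript \<open>k\<close> contains \<open>k\<close> consecutive diagonal elements
  starting at \<open>p + 1\<close>.\<close>

lemma mset_eq_of_tail_sums:
  fixes M N :: "nat multiset"
  assumes "\<And>l. (\<Sum>k\<in>#M. of_bool (l \<le> k)) = (\<Sum>k\<in>#N. of_bool (l \<le> k) :: nat)"
  shows "M = N"
proof (rule multiset_eqI)
  fix m
  have "(\<Sum>k\<in>#M. of_bool (m \<le> k)) = count M m + (\<Sum>k\<in>#M. of_bool (Suc m \<le> k))" for M :: "nat multiset"
    by (induction M) auto
  then show "count M m = count N m"
    using assms[of m] assms[of "Suc m"] by simp
qed

section \<open>Relations between words on the two sides\<close>

definition cell_count :: "nat \<Rightarrow> nat \<Rightarrow> (int list \<times> nat) list \<Rightarrow> qelt \<Rightarrow> nat" where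
  "cell_count p n ws q = (\<Sum>g\<leftarrow>ws. of_bool (q \<in> cells p n g))"

lemma row_sum_cells:
  assumes g: "g \<in> I_pbw p n"
  shows "(\<Sum>b\<in>{int a..<int a + int n}. of_bool ((int a, b) \<in> cells p n g)) =
    (of_bool (snd g < a \<and> a \<le> snd g + p) :: nat)"
proof -
  obtain I k where Ik: "g = (I, k)" by (cases g)
  show ?thesis
  proof (cases "k < a \<and> a \<le> k + p")
    case True
    define c where "c = snd (cell n I k (a - k - 1))"
    have j: "a - k - 1 < p" "k + (a - k - 1) + 1 = a" using True by auto
    have cell_c: "cell n I k (a - k - 1) = (int a, c)"
      using j(2) by (simp add: c_def cell_def)
    have iff: "(int a, b) \<in> cells p n g \<longleftrightarrow> b = c" for b
    proof
      assume "(int a, b) \<in> cells p n g"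
      then obtain i where i: "(int a, b) = cell n I k i" by (auto simp: Ik cells_def)
      then have "i = a - k - 1" by (auto simp: cell_def)
      then show "b = c" using i cell_c by simp
    next
      have "cell n I k (a - k - 1) \<in> cells p n g"
        unfolding Ik cells_def prod.case by (intro imageI) (use j(1) in simp)
      moreover assume "b = c"
      ultimately show "(int a, b) \<in> cells p n g" using cell_c by simp
    qed
    have "(int a, c) \<in> cells p n g" using iff by simp
    then have "c \<in> {int a..<int a + int n}"
      using cells_subset[of I k p n] g by (auto simp: Ik cell_space_def)
    then show ?thesis using True unfolding iff by (simp add: Ik of_bool_def)
  next
    case False
    then have "(int a, b) \<notin> cells p n g" for b
      by (auto simp: Ik elim!: cellsE)
    then show ?thesis using False by (simp add: Ik)
  qed
qed

lemma row_sum_cell_count: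
  assumes "ws \<in> lists (I_pbw p n)"
  shows "(\<Sum>b\<in>{int a..<int a + int n}. cell_count p n ws (int a, b)) =
    (\<Sum>k\<in>#mset (map snd ws). of_bool (k < a \<and> a \<le> k + p))"
  using assms
proof (induction ws)
  case (Cons g ws)
  then show ?case
    using row_sum_cells[of g p n a] by (simp add: cell_count_def sum.distrib)
qed (simp add: cell_count_def)

text \<open>The diagonal cells of a word need not be compared: a generator with superscript \<open>k\<close> has exactly
  one cell in each of the rows \<open>k + 1, \<dots>, k + p\<close>.\<close>

definition word_equiv :: "nat \<Rightarrow> nat \<Rightarrow> (int list \<times> nat) list \<Rightarrow> (int list \<times> nat) list \<Rightarrow> bool" where
  "word_equiv p n ws ws' \<longleftrightarrow>
     (\<forall>a b. a \<noteq> b \<longrightarrow> cell_count p n ws (a, b) = cell_count p n ws' (a, b)) \<and>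
     mset (map snd ws) = mset (map snd ws')"

definition z_monomial :: "nat \<Rightarrow> nat \<Rightarrow> int list \<times> nat \<Rightarrow> zvar monomial" where
  "z_monomial p n g = set_monomial (zcell p n ` cells p n g)"

definition y_monomial :: "nat \<Rightarrow> nat \<Rightarrow> int list \<times> nat \<Rightarrow> qelt monomial" where
  "y_monomial p n g = set_monomial
     {q. if fst q = snd q then fst q \<in> {int p + 1..int (snd g + p)} else q \<in> cells p n g}"

lemma finite_y_support:
  "finite {q. if fst q = snd q then fst q \<in> {int p + 1..int (snd g + p)} else q \<in> cells p n g}"
proof (rule finite_subset)
  show "{q. if fst q = snd q then fst q \<in> {int p + 1..int (snd g + p)} else q \<in> cells p n g} \<subseteq>
      {int p + 1..int (snd g + p)} \<times> {int p + 1..int (snd g + p)} \<union> cells p n g"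
    by (auto split: if_splits)
qed (simp add: finite_cells)

lemma lookup_z_monomial_word:
  assumes ws: "ws \<in> lists (I_pbw p n)" and p: "1 \<le> p" and q: "q \<in> cell_space n"
  shows "Poly_Mapping.lookup (sum_list (map (z_monomial p n) ws)) (zcell p n q) = cell_count p n ws q"
  unfolding lookup_sum_list cell_count_def
proof (rule arg_cong[where f = sum_list], rule map_cong)
  fix g assume "g \<in> set ws"
  then have "cells p n g \<subseteq> cell_space n"
    using ws cells_subset[of "fst g" "snd g" p n] by auto
  then have "zcell p n q \<in> zcell p n ` cells p n g \<longleftrightarrow> q \<in> cells p n g"
    using zcell_inj[OF p, of n] q by (auto dest: inj_onD)
  then show "Poly_Mapping.lookup (z_monomial p n g) (zcell p n q) = of_bool (q \<in> cells p n g)"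
    by (simp add: z_monomial_def lookup_set_monomial finite_cells)
qed simp

lemma cell_count_outside:
  assumes ws: "ws \<in> lists (I_pbw p n)" and q: "q \<notin> cell_space n"
  shows "cell_count p n ws q = 0"
proof -
  have "of_bool (q \<in> cells p n g) = (0::nat)" if "g \<in> set ws" for g
    using ws q that cells_subset[of "fst g" "snd g" p n] by auto
  then show ?thesis unfolding cell_count_def by (simp cong: map_cong)
qed

text \<open>The z-exponents are the cell counts, and summing them over a row gives a window sum of
  superscripts.\<close>

lemma z_monomial_word_eq_iff:
  assumes ws: "ws \<in> lists (I_pbw p n)" "ws' \<in> lists (I_pbw p n)" and p: "1 \<le> p" "0 < n"
  shows "sum_list (map (z_monomial p n) ws) = sum_list (map (z_monomial p n) ws') \<longleftrightarrow>
    word_equiv p n ws ws'"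
proof
  assume eq: "sum_list (map (z_monomial p n) ws) = sum_list (map (z_monomial p n) ws')"
  have count: "cell_count p n ws q = cell_count p n ws' q" for q
  proof (cases "q \<in> cell_space n")
    case True
    then show ?thesis
      using lookup_z_monomial_word[OF ws(1) p(1), of q] lookup_z_monomial_word[OF ws(2) p(1), of q] eq by simp
  qed (simp add: cell_count_outside ws)
  have "mset (map snd ws) = mset (map snd ws')"
    by (rule mset_eq_of_window_sums[OF p(1)])
      (simp only: row_sum_cell_count[OF ws(1), symmetric] row_sum_cell_count[OF ws(2), symmetric] count)
  then show "word_equiv p n ws ws'" using count by (simp add: word_equiv_def)
next
  assume equiv: "word_equiv p n ws ws'"
  have off: "cell_count p n ws (a, b) = cell_count p n ws' (a, b)" if "a \<noteq> b" for a b
    using equiv that by (simp add: word_equiv_def)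
  \<comment> \<open>The superscripts fix the row sum, and subtracting the off-diagonal counts leaves
    the diagonal one.\<close>
  have diag: "cell_count p n ws (a, a) = cell_count p n ws' (a, a)" for a
  proof (cases "(a, a) \<in> cell_space n")
    case True
    then obtain m where m: "a = int m" by (metis (no_types, lifting) cell_space_def case_prodD mem_Collect_eq
          nonneg_int_cases order_trans zero_le_one)
    have split: "{int m..<int m + int n} = insert (int m) {int m + 1..<int m + int n}"
      using p by auto
    have "(\<Sum>b\<in>{int m + 1..<int m + int n}. cell_count p n ws (int m, b)) =
        (\<Sum>b\<in>{int m + 1..<int m + int n}. cell_count p n ws' (int m, b))"
      by (rule sum.cong) (use off in auto)
    moreover have "(\<Sum>b\<in>{int m..<int m + int n}. cell_count p n ws (int m, b)) =
        (\<Sum>b\<in>{int m..<int m + int n}. cell_count p n ws' (int m, b))"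
      using equiv by (simp only: row_sum_cell_count ws word_equiv_def)
    ultimately show ?thesis unfolding split m by simp
  qed (simp add: cell_count_outside ws)
  have count: "cell_count p n ws q = cell_count p n ws' q" for q
    using off diag by (cases q) metis
  show "sum_list (map (z_monomial p n) ws) = sum_list (map (z_monomial p n) ws')"
  proof (rule poly_mapping_eqI)
    fix z
    show "Poly_Mapping.lookup (sum_list (map (z_monomial p n) ws)) z =
        Poly_Mapping.lookup (sum_list (map (z_monomial p n) ws')) z"
    proof (cases "z \<in> zvars p n")
      case True
      then obtain q where "q \<in> cell_space n" "z = zcell p n q" using zvars_zcell[OF p] by metis
      then show ?thesis using lookup_z_monomial_word[OF _ p(1)] ws count by simp
    next
      case False
      then have "z \<notin> zcell p n ` A" for A using zcell_zvars[OF p] by blast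
      then have "Poly_Mapping.lookup (z_monomial p n g) z = 0" for g
        by (simp add: z_monomial_def lookup_set_monomial finite_cells)
      then show ?thesis by (simp add: lookup_sum_list)
    qed
  qed
qed

lemma lookup_y_monomial_word:
  "Poly_Mapping.lookup (sum_list (map (y_monomial p n) ws)) (a, b) =
    (if a = b then (\<Sum>k\<in>#mset (map snd ws). of_bool (a \<in> {int p + 1..int (k + p)})) else cell_count p n ws (a, b))"
  unfolding sum_list_snd_eq_mset[symmetric] lookup_sum_list cell_count_def y_monomial_def
  by (simp add: lookup_set_monomial[OF finite_y_support])

lemma y_monomial_word_eq_iff:
  "length ws = length ws' \<and> sum_list (map (y_monomial p n) ws) = sum_list (map (y_monomial p n) ws') \<longleftrightarrow>
    word_equiv p n ws ws'"
proof
  assume eq: "length ws = length ws' \<and> sum_list (map (y_monomial p n) ws) = sum_list (map (y_monomial p n) ws')"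
  then have lookup: "Poly_Mapping.lookup (sum_list (map (y_monomial p n) ws)) (a, b) =
      Poly_Mapping.lookup (sum_list (map (y_monomial p n) ws')) (a, b)" for a b by simp
  have "mset (map snd ws) = mset (map snd ws')"
  proof (rule mset_eq_of_tail_sums)
    fix l
    show "(\<Sum>k\<in>#mset (map snd ws). of_bool (l \<le> k)) = (\<Sum>k\<in>#mset (map snd ws'). of_bool (l \<le> k) :: nat)"
    proof (cases l)
      \<comment> \<open>The diagonal starts at \<open>p + 1\<close>, so no y-exponent shows this
        tail; it is the number of factors, known from the degree in \<open>s\<close>.\<close>
      case 0
      have "(\<Sum>k\<in>#mset (map snd xs). of_bool (l \<le> k) :: nat) = length xs" for xs :: "(int list \<times> nat) list"
        by (induction xs) (simp_all add: 0)
      then show ?thesis using eq by simp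
    next
      case (Suc m)
      have "of_bool (int (l + p) \<in> {int p + 1..int (k + p)}) = (of_bool (l \<le> k) :: nat)" for k
        using Suc by auto
      then show ?thesis
        using lookup[of "int (l + p)" "int (l + p)"] unfolding lookup_y_monomial_word by simp
    qed
  qed
  then show "word_equiv p n ws ws'"
    using lookup unfolding lookup_y_monomial_word word_equiv_def by metis
next
  assume equiv: "word_equiv p n ws ws'"
  then have m: "mset (map snd ws) = mset (map snd ws')" by (simp add: word_equiv_def)
  have "sum_list (map (y_monomial p n) ws) = sum_list (map (y_monomial p n) ws')"
  proof (rule poly_mapping_eqI)
    fix q :: qelt
    obtain a b where q: "q = (a, b)" by (cases q)
    show "Poly_Mapping.lookup (sum_list (map (y_monomial p n) ws)) q =
        Poly_Mapping.lookup (sum_list (map (y_monomial p n) ws')) q"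
      unfolding q lookup_y_monomial_word m using equiv by (simp add: word_equiv_def)
  qed
  moreover have "length ws = length ws'"
    using arg_cong[OF m, of size] by simp
  ultimately show "length ws = length ws' \<and>
      sum_list (map (y_monomial p n) ws) = sum_list (map (y_monomial p n) ws')" by simp
qed

section \<open>Assembling the isomorphism\<close>

lemma s_y_phi_pbw:
  assumes g: "(I, k) \<in> I_pbw p n" and p: "1 \<le> p" "p < n"
    and Os: "Os = {q \<in> Q_poset p n. fst q = snd q}" and Cs: "Cs = Q_poset p n - Os"
  shows "s_y (v_OC p n Os Cs (phi_pbw p n I k)) = monom (Poly_Mapping.single (y_monomial p n (I, k)) 1) 1"
proof -
  let ?v = "v_OC p n Os Cs (phi_pbw p n I k)"
  let ?B = "{q. if fst q = snd q then fst q \<in> {int p + 1..int (snd (I, k) + p)} else q \<in> cells p n (I, k)}"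
  have v: "?v q = of_bool (q \<in> ?B)" for q
    unfolding v_OC_phi_pbw[OF g p Os Cs] by simp
  then have supp: "{q. ?v q \<noteq> 0} = ?B" by simp
  have "?v q = 1" if "q \<in> ?B" for q
    unfolding v using that by (simp only: of_bool_eq)
  then have "y_power ?v = (\<Prod>q\<in>?B. cpoly_var q)"
    unfolding y_power_def by (intro prod.cong[OF supp]) (simp only: power_one_right)
  then show ?thesis
    unfolding s_y_def y_monomial_def set_monomial_def by (simp only: prod_cpoly_var[OF finite_y_support])
qed

theorem lemma5p9:
  fixes p n :: nat and Os Cs :: "qelt set"
  assumes "1 \<le> p" and "p < n"
    and "Os = {q \<in> Q_poset p n. fst q = snd q}"
    and "Cs = Q_poset p n - Os"
  shows "\<exists>f. graded_algebra_iso
               cpoly_const (A_pbw p n) (A_pbw_degree p n)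
               ys_const (A_OC p n Os Cs) (A_OC_degree p n Os Cs) f \<and>
             (\<forall>I k r. (I, k) \<in> I_pbw p n \<and> r \<in> {0..p - 1} \<and> k mod p = r mod p \<longrightarrow>
                f (in_pbw_D p n I k) =
                  (-1) ^ (r * (p - 1)) * s_y (v_OC p n Os Cs (phi_pbw p n I k)))"
proof -
  note p = assms(1,2) and OC = assms(3,4)
  have n: "0 < n" using p by simp
  let ?G = "I_pbw p n" and ?u = "z_monomial p n" and ?v = "y_monomial p n"
  define S where "S = {sum_list (map ?u ws) |ws. ws \<in> lists ?G}"
  \<comment> \<open>One exponent can come from many words. An arbitrary one is chosen, and
    \<open>word_eq\<close> makes length and y-monomial independent of the choice.\<close>
  define word where "word m = (SOME ws. ws \<in> lists ?G \<and> sum_list (map ?u ws) = m)" for m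
  define d where "d m = length (word m)" for m
  define w where "w m = sum_list (map ?v (word m))" for m
  have word_eq: "sum_list (map ?u ws) = sum_list (map ?u ws') \<longleftrightarrow>
      length ws = length ws' \<and> sum_list (map ?v ws) = sum_list (map ?v ws')"
    if "ws \<in> lists ?G" "ws' \<in> lists ?G" for ws ws'
    unfolding z_monomial_word_eq_iff[OF that p(1) n] y_monomial_word_eq_iff ..
  have dw: "d (sum_list (map ?u ws)) = length ws" "w (sum_list (map ?u ws)) = sum_list (map ?v ws)"
    if ws: "ws \<in> lists ?G" for ws
  proof -
    have "word (sum_list (map ?u ws)) \<in> lists ?G \<and>
        sum_list (map ?u (word (sum_list (map ?u ws)))) = sum_list (map ?u ws)"
      unfolding word_def by (rule someI[of _ ws]) (use ws in simp)
    then show "d (sum_list (map ?u ws)) = length ws" "w (sum_list (map ?u ws)) = sum_list (map ?v ws)"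
      using word_eq[OF _ ws] unfolding d_def w_def by blast+
  qed
  have dw_gen: "d (?u g) = 1" "w (?u g) = ?v g" if "g \<in> ?G" for g
    using dw[of "[g]"] that by simp_all
  have mdegree_u: "mdegree (?u g) = p" if "g \<in> ?G" for g
  proof -
    have "inj_on (zcell p n) (cells p n g)"
      using cells_subset[of "fst g" "snd g" p n] that zcell_inj[OF p(1)] by (auto intro: inj_on_subset)
    then show ?thesis
      using card_cells[of p n "fst g" "snd g"]
      by (simp add: z_monomial_def mdegree_set_monomial finite_cells card_image)
  qed
  have mdegree_word: "mdegree (sum_list (map ?u ws)) = p * length ws" if "ws \<in> lists ?G" for ws
    using that by (induction ws) (simp_all add: mdegree_add mdegree_u, simp add: mdegree_def)
  let ?X = "{in_pbw_D p n I k |I k. (I, k) \<in> ?G}"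
  let ?Y = "{s_y (v_OC p n Os Cs J) |J. J \<in> order_ideals p n}"
  let ?f = "lin_ext ys_const (\<lambda>m. monom (Poly_Mapping.single (w m) 1) (d m))"
  have in_D: "in_pbw_D p n I k = Poly_Mapping.single (?u (I, k)) ((-1) ^ ((k mod p) * (p - 1)))"
    if "(I, k) \<in> ?G" for I k
    unfolding z_monomial_def using in_pbw_D_eq[OF that p(1) n] .
  have "graded_algebra_iso
      cpoly_const (generated_subalgebra cpoly_const ?X)
      (\<lambda>e. {P \<in> generated_subalgebra cpoly_const ?X. \<forall>m\<in>Poly_Mapping.keys P. mdegree m = p * e})
      ys_const (generated_subalgebra ys_const ?Y)
      (\<lambda>e. {g \<in> generated_subalgebra ys_const ?Y. \<forall>e'. e' \<noteq> e \<longrightarrow> coeff g e' = 0}) ?f"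
  proof (rule monomial_algebra_iso[OF S_def])
    fix a b assume "a \<in> S" "b \<in> S"
    then obtain ws ws' where ws: "ws \<in> lists ?G" "a = sum_list (map ?u ws)"
      "ws' \<in> lists ?G" "b = sum_list (map ?u ws')" unfolding S_def by blast
    have "a + b = sum_list (map ?u (ws @ ws'))" "ws @ ws' \<in> lists ?G" using ws by auto
    then show "d (a + b) = d a + d b \<and> w (a + b) = w a + w b"
      using dw[of "ws @ ws'"] dw ws by simp
    show "a = b" if "d a = d b" "w a = w b"
      using that word_eq[OF ws(1,3)] dw ws by simp
  next
    fix a assume "a \<in> S"
    then obtain ws where "ws \<in> lists ?G" "a = sum_list (map ?u ws)" unfolding S_def by blast
    then show "mdegree a = p * d a" using mdegree_word dw by simp
  next
    fix x assume "x \<in> ?X"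
    then obtain I k where Ik: "(I, k) \<in> ?G" "x = in_pbw_D p n I k" by blast
    then show "\<exists>c. \<exists>g\<in>?G. x = cpoly_const c * Poly_Mapping.single (?u g) 1"
      using in_D by (intro exI bexI[OF _ Ik(1)]) (simp add: cpoly_const_def mult_single)
  next
    fix g assume g: "g \<in> ?G"
    obtain I k where Ik: "g = (I, k)" by (cases g)
    \<comment> \<open>The sign is its own inverse, so multiplying by it again recovers the bare
      monomial.\<close>
    have "Poly_Mapping.single (?u g) 1 =
        cpoly_const ((-1) ^ ((k mod p) * (p - 1))) * in_pbw_D p n I k"
      using in_D[of I k] g by (simp add: Ik cpoly_const_def mult_single power_mult_distrib[symmetric])
    then show "\<exists>c. \<exists>x\<in>?X. Poly_Mapping.single (?u g) 1 = cpoly_const c * x"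
      using g unfolding Ik by blast
  next
    \<comment> \<open>Every ideal comes from a symbol, so both algebras have generators indexed by
      the same set.\<close>
    have "?Y = {s_y (v_OC p n Os Cs (phi_pbw p n I k)) |I k. (I, k) \<in> ?G}"
      using phi_pbw_surj[OF _ p] phi_pbw_order_ideal[OF _ p(2)] by (metis (no_types, lifting))
    also have "\<dots> = (\<lambda>g. monom (Poly_Mapping.single (?v g) 1) 1) ` ?G"
      using s_y_phi_pbw[OF _ p OC] by force
    also have "\<dots> = (\<lambda>g. monom (Poly_Mapping.single (w (?u g)) 1) (d (?u g))) ` ?G"
      by (rule image_cong) (simp_all add: dw_gen)
    finally show "?Y = (\<lambda>g. monom (Poly_Mapping.single (w (?u g)) 1) (d (?u g))) ` ?G" .
  qed (use p in simp)
  moreover have "?f (in_pbw_D p n I k) = (-1) ^ (r * (p - 1)) * s_y (v_OC p n Os Cs (phi_pbw p n I k))"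
    if "(I, k) \<in> ?G" "r \<in> {0..p - 1}" "k mod p = r mod p" for I k r
  proof -
    have r: "k mod p = r" using that p by auto
    have "ys_const 1 = 1" "ys_const (- 1) = - 1"
      by (simp_all add: ys_const_def cpoly_const_def one_pCons single_uminus)
    then have const: "ys_const ((-1) ^ e) = (-1) ^ e" for e
      by (cases "even e") simp_all
    have "?f (in_pbw_D p n I k) = ys_const ((-1) ^ (r * (p - 1))) * monom (Poly_Mapping.single (?v (I, k)) 1) 1"
      unfolding in_D[OF that(1)] r by (simp add: lin_ext_def dw_gen that(1))
    then show ?thesis unfolding const s_y_phi_pbw[OF that(1) p OC] .
  qed
  ultimately show ?thesis
    unfolding A_pbw_def A_OC_def A_pbw_degree_def[abs_def] A_OC_degree_def[abs_def] by blast
qed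

end
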